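(* The finite dimensional, indecomposable, real representations of $iD_\infty$ are, up to isomorphism, precisely the representations of the form $$V=\mathbb{R}[t]/(p^{n})\oplus b\,\mathbb{R}[t]/(p^{n}),$$ where $n\in\mathbb{N}$, $a$ acts by multiplication by $t$ on $\mathbb{R}[t]/(p^n)$, and $p\in\mathbb{R}[t]$ is of one of the following two types: (1) $p=t-r$ with $r\in\mathbb{R}\setminus\{0\}$; (2) $p=(t-c)(t-\overline{c})$ with $c\in\mathbb{C}\setminus\mathbb{R}$.
   Context: $iD_\infty$ is the associative unital algebra over $\mathbb{R}$ generated by two elements $a,b$ ($a$ and $b$ invertible) subject to the relations $bab^{-1}=a^{-1}$ and $b^2=-1$. A real representation is a left $iD_\infty$-module that is a real vector space. $\mathbb{N}=\{1,2,\dots\}$. Notation: for $p\in\mathbb{R}[t]$ with $p(0)\neq 0$ (so that $t$ is invertible in $\mathbb{R}[t]/(p^n)$), $V=\mathbb{R}[t]/(p^{n})\oplus b\,\mathbb{R}[t]/(p^{n})$ denotes the $iD_\infty$-module whose underlying vector space is the direct sum of $\mathbb{R}[t]/(p^n)$ and a second copy of it, with elements written $b f$ for $f\in\mathbb{R}[t]/(p^n)$, and with action, for $f\in \mathbb{R}[t]/(p^n)$, $$a\cdot f=tf,\quad a\cdot (bf)=b(t^{-1}f),\quad b\cdot f=bf,\quad b\cdot(bf)=-f.$$ *)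

theory Defs
  imports
    "HOL-Analysis.Analysis"
    "HOL-Library.Poly_Mapping"
    "HOL-Computational_Algebra.Polynomial"
begin

text \<open>Invertibility of \<open>a\<close> and \<open>b\<close> is part of the presentation: each generator comes with a
  formal inverse, and the corresponding relations are among the relators below.\<close>

datatype iD_letter = La | La_inv | Lb | Lb_inv

datatype iD_word = Word (letters: "iD_letter list")

instantiation iD_word :: monoid_add
begin

definition zero_iD_word :: iD_word where "0 = Word []"

definition plus_iD_word :: "iD_word \<Rightarrow> iD_word \<Rightarrow> iD_word"
  where "u + v = Word (letters u @ letters v)"

instance
  by standard (simp_all add: zero_iD_word_def plus_iD_word_def)

end

lemma letters_zero [simp]: "letters 0 = []"
  by (simp add: zero_iD_word_def)

lemma letters_plus [simp]: "letters (u + v) = letters u @ letters v"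
  by (simp add: plus_iD_word_def)

text \<open>Finitely supported real functions on words with the convolution product, i.e. the
  noncommutative polynomials in the four letters.\<close>

type_synonym iD_free = "iD_word \<Rightarrow>\<^sub>0 real"

definition fletter :: "iD_letter \<Rightarrow> iD_free"
  where "fletter l = Poly_Mapping.single (Word [l]) 1"

definition fscale :: "real \<Rightarrow> iD_free \<Rightarrow> iD_free"
  where "fscale r x = Poly_Mapping.single 0 r * x"

definition iD_relators :: "iD_free set"
  where "iD_relators =
    {fletter La * fletter La_inv - 1, fletter La_inv * fletter La - 1,
     fletter Lb * fletter Lb_inv - 1, fletter Lb_inv * fletter Lb - 1,
     fletter Lb * fletter La * fletter Lb_inv - fletter La_inv,
     fletter Lb * fletter Lb + 1}"

inductive_set iD_ideal :: "iD_free set" where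
  zero: "0 \<in> iD_ideal"
| relator: "x \<in> iD_relators \<Longrightarrow> x \<in> iD_ideal"
| add: "x \<in> iD_ideal \<Longrightarrow> y \<in> iD_ideal \<Longrightarrow> x + y \<in> iD_ideal"
| left: "x \<in> iD_ideal \<Longrightarrow> z * x \<in> iD_ideal"
| right: "x \<in> iD_ideal \<Longrightarrow> x * z \<in> iD_ideal"

lemma iD_ideal_uminus: "x \<in> iD_ideal \<Longrightarrow> - x \<in> iD_ideal"
  using iD_ideal.left[of x "-1"] by simp

lemma iD_ideal_diff: "x \<in> iD_ideal \<Longrightarrow> y \<in> iD_ideal \<Longrightarrow> x - y \<in> iD_ideal"
  using iD_ideal.add[of x "- y"] iD_ideal_uminus[of y] by simp

quotient_type iDinf = iD_free / "\<lambda>x y. x - y \<in> iD_ideal"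
proof (rule equivpI)
  show "reflp (\<lambda>x y. x - y \<in> iD_ideal)"
    by (simp add: reflp_def iD_ideal.zero)
  show "symp (\<lambda>x y. x - y \<in> iD_ideal)"
    by (rule sympI) (metis iD_ideal_uminus minus_diff_eq)
  show "transp (\<lambda>x y. x - y \<in> iD_ideal)"
    by (rule transpI) (use iD_ideal.add in fastforce)
qed

definition word_op :: "(iD_letter \<Rightarrow> 'v \<Rightarrow> 'v) \<Rightarrow> iD_word \<Rightarrow> 'v \<Rightarrow> 'v"
  where "word_op \<phi> w = foldr \<phi> (letters w)"

definition free_op :: "(iD_letter \<Rightarrow> 'v \<Rightarrow> 'v) \<Rightarrow> iD_free \<Rightarrow> 'v \<Rightarrow> 'v::real_vector"
  where "free_op \<phi> x v = (\<Sum>w\<in>Poly_Mapping.keys x. Poly_Mapping.lookup x w *\<^sub>R word_op \<phi> w v)"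

lemma word_op_zero [simp]: "word_op \<phi> 0 v = v"
  by (simp add: word_op_def)

lemma word_op_plus: "word_op \<phi> (u + w) v = word_op \<phi> u (word_op \<phi> w v)"
  by (simp add: word_op_def)

lemma free_op_superset:
  assumes "finite S" "Poly_Mapping.keys x \<subseteq> S"
  shows "free_op \<phi> x v = (\<Sum>w\<in>S. Poly_Mapping.lookup x w *\<^sub>R word_op \<phi> w v)"
  unfolding free_op_def using assms
  by (intro sum.mono_neutral_left) (auto simp: in_keys_iff)

lemma free_op_add: "free_op \<phi> (x + y) v = free_op \<phi> x v + free_op \<phi> y v"
proof -
  let ?S = "Poly_Mapping.keys x \<union> Poly_Mapping.keys y"
  have "Poly_Mapping.keys (x + y) \<subseteq> ?S" by (rule Poly_Mapping.keys_add)
  then show ?thesis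
    by (simp add: free_op_superset[of ?S] lookup_add scaleR_add_left sum.distrib)
qed

lemma free_op_zero [simp]: "free_op \<phi> 0 v = 0"
  by (simp add: free_op_def)

lemma free_op_uminus: "free_op \<phi> (- x) v = - free_op \<phi> x v"
  using free_op_add[of \<phi> x "- x" v] by (simp add: add_eq_0_iff2 minus_unique)

lemma free_op_diff: "free_op \<phi> (x - y) v = free_op \<phi> x v - free_op \<phi> y v"
  using free_op_add[of \<phi> x "- y" v] by (simp add: free_op_uminus)

lemma free_op_single: "free_op \<phi> (Poly_Mapping.single w c) v = c *\<^sub>R word_op \<phi> w v"
  by (cases "c = 0") (simp_all add: free_op_def)

lemma free_op_one [simp]: "free_op \<phi> 1 v = v"
  using free_op_single[of \<phi> 0 1 v] by simp

lemma free_op_fletter [simp]: "free_op \<phi> (fletter l) v = \<phi> l v"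
  by (simp add: fletter_def free_op_single word_op_def)

lemma iD_free_induct [case_names zero single add]:
  fixes x :: iD_free
  assumes "P 0" "\<And>w c. P (Poly_Mapping.single w c)" "\<And>x y. P x \<Longrightarrow> P y \<Longrightarrow> P (x + y)"
  shows "P x"
proof -
  have "P (\<Sum>w\<in>S. Poly_Mapping.single w (Poly_Mapping.lookup x w))" if "finite S" for S
    using that by induction (auto intro: assms)
  moreover have "x = (\<Sum>w\<in>Poly_Mapping.keys x. Poly_Mapping.single w (Poly_Mapping.lookup x w))"
    by (rule poly_mapping_eqI) (auto simp: lookup_sum lookup_single when_def in_keys_iff)
  ultimately show ?thesis by (metis finite_keys)
qed

context
  fixes \<phi> :: "iD_letter \<Rightarrow> 'v \<Rightarrow> 'v::real_vector"
  assumes lin: "\<And>l. linear (\<phi> l)"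
begin

lemma linear_word_op: "linear (word_op \<phi> w)"
proof (cases w)
  case (Word ls)
  have "linear (foldr \<phi> ls)"
    by (induction ls) (auto simp: o_def lin linear_compose[unfolded o_def] linear_id[unfolded id_def])
  with Word show ?thesis by (simp add: word_op_def)
qed

lemma linear_free_op: "linear (free_op \<phi> x)"
  unfolding free_op_def[abs_def]
  by (intro linear_compose_sum ballI linear_compose_scale_right linear_word_op)

lemma free_op_mult: "free_op \<phi> (x * y) v = free_op \<phi> x (free_op \<phi> y v)"
proof (induction x rule: iD_free_induct)
  case zero
  then show ?case by simp
next
  case (single w c)
  show ?case
  proof (induction y rule: iD_free_induct)
    case zero
    then show ?case using linear_0[OF linear_free_op] by simp
  next
    case (single w' c')
    then show ?case
      by (simp add: mult_single free_op_single word_op_plus linear_scale[OF linear_word_op])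
  next
    case (add y z)
    then show ?case
      by (simp add: distrib_left free_op_add linear_add[OF linear_free_op])
  qed
next
  case (add x y)
  then show ?case by (simp add: distrib_right free_op_add)
qed

lemma free_op_fscale: "free_op \<phi> (fscale r x) v = r *\<^sub>R free_op \<phi> x v"
  by (simp add: fscale_def free_op_mult free_op_single)

lemma free_op_closed:
  assumes "subspace V" "\<And>l u. u \<in> V \<Longrightarrow> \<phi> l u \<in> V" "v \<in> V"
  shows "free_op \<phi> x v \<in> V"
proof -
  have "foldr \<phi> ls v \<in> V" for ls by (induction ls) (auto simp: assms)
  then show ?thesis
    unfolding free_op_def word_op_def by (intro subspace_sum subspace_scale assms(1))
qed

lemma free_op_ideal:
  assumes "x \<in> iD_ideal" "v \<in> V" and V: "subspace V" "\<And>l u. u \<in> V \<Longrightarrow> \<phi> l u \<in> V"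
    and rels: "\<And>r u. r \<in> iD_relators \<Longrightarrow> u \<in> V \<Longrightarrow> free_op \<phi> r u = 0"
  shows "free_op \<phi> x v = 0"
  using assms(1,2)
proof (induction arbitrary: v)
  case (left x z)
  then show ?case using linear_0[OF linear_free_op] by (simp add: free_op_mult)
next
  case (right x z)
  then show ?case using free_op_closed[OF V] by (simp add: free_op_mult)
qed (simp_all add: rels free_op_add)

end

text \<open>Nontriviality is witnessed by the one-dimensional complex representation with \<open>a\<close> acting
  as \<open>1\<close> and \<open>b\<close> as \<open>\<i>\<close>.\<close>

lemma one_notin_iD_ideal: "1 \<notin> iD_ideal"
proof
  assume one: "1 \<in> iD_ideal"
  define \<phi> :: "iD_letter \<Rightarrow> complex \<Rightarrow> complex" where
    "\<phi> l z = (case l of La \<Rightarrow> z | La_inv \<Rightarrow> z | Lb \<Rightarrow> \<i> * z | Lb_inv \<Rightarrow> - \<i> * z)" for l z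
  have lin: "linear (\<phi> l)" for l
    by (cases l; rule linearI; simp add: \<phi>_def algebra_simps)
  have "free_op \<phi> 1 1 = 0"
    by (rule free_op_ideal[OF lin one, where V = UNIV])
       (auto simp: iD_relators_def free_op_diff free_op_add free_op_mult[OF lin] \<phi>_def)
  then show False by simp
qed

instantiation iDinf :: real_algebra_1
begin

lift_definition zero_iDinf :: iDinf is 0 .

lift_definition one_iDinf :: iDinf is 1 .

lift_definition plus_iDinf :: "iDinf \<Rightarrow> iDinf \<Rightarrow> iDinf" is "(+)"
  by (metis iD_ideal.add add_diff_add)

lift_definition uminus_iDinf :: "iDinf \<Rightarrow> iDinf" is uminus
  by (metis iD_ideal_uminus minus_diff_minus)

lift_definition minus_iDinf :: "iDinf \<Rightarrow> iDinf \<Rightarrow> iDinf" is "(-)"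
proof -
  fix x x' y y' :: iD_free
  assume "x - x' \<in> iD_ideal" "y - y' \<in> iD_ideal"
  then have "(x - x') - (y - y') \<in> iD_ideal" by (rule iD_ideal_diff)
  then show "(x - y) - (x' - y') \<in> iD_ideal" by (simp add: algebra_simps)
qed

lift_definition times_iDinf :: "iDinf \<Rightarrow> iDinf \<Rightarrow> iDinf" is "(*)"
proof -
  fix x x' y y' :: iD_free
  assume "x - x' \<in> iD_ideal" "y - y' \<in> iD_ideal"
  then have "(x - x') * y + x' * (y - y') \<in> iD_ideal"
    by (intro iD_ideal.add iD_ideal.left iD_ideal.right)
  then show "x * y - x' * y' \<in> iD_ideal" by (simp add: algebra_simps)
qed

lift_definition scaleR_iDinf :: "real \<Rightarrow> iDinf \<Rightarrow> iDinf" is fscale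
  unfolding fscale_def by (metis iD_ideal.left right_diff_distrib)

instance
proof
  have sc: "Poly_Mapping.single 0 r * x = x * Poly_Mapping.single 0 r" for r and x :: iD_free
    by (induction x rule: iD_free_induct) (simp_all add: algebra_simps mult_single)
  fix x y z :: iDinf and r s :: real
  show "x + y + z = x + (y + z)" by transfer (simp add: algebra_simps iD_ideal.zero)
  show "x + y = y + x" by transfer (simp add: algebra_simps iD_ideal.zero)
  show "0 + x = x" by transfer (simp add: iD_ideal.zero)
  show "- x + x = 0" by transfer (simp add: iD_ideal.zero)
  show "x - y = x + - y" by transfer (simp add: iD_ideal.zero)
  show "x * y * z = x * (y * z)" by transfer (simp add: algebra_simps iD_ideal.zero)
  show "(x + y) * z = x * z + y * z" by transfer (simp add: algebra_simps iD_ideal.zero)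
  show "x * (y + z) = x * y + x * z" by transfer (simp add: algebra_simps iD_ideal.zero)
  show "1 * x = x" by transfer (simp add: iD_ideal.zero)
  show "x * 1 = x" by transfer (simp add: iD_ideal.zero)
  show "(0::iDinf) \<noteq> 1"
    by transfer (use one_notin_iD_ideal iD_ideal_uminus[of "- 1"] in auto)
  show "r *\<^sub>R (x + y) = r *\<^sub>R x + r *\<^sub>R y"
    by transfer (simp add: fscale_def algebra_simps iD_ideal.zero)
  show "(r + s) *\<^sub>R x = r *\<^sub>R x + s *\<^sub>R x"
    by transfer (simp add: fscale_def single_add algebra_simps iD_ideal.zero)
  show "r *\<^sub>R s *\<^sub>R x = (r * s) *\<^sub>R x"
    by transfer (simp add: fscale_def mult_single iD_ideal.zero flip: mult.assoc)
  show "1 *\<^sub>R x = x" by transfer (simp add: fscale_def iD_ideal.zero)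
  show "r *\<^sub>R x * y = r *\<^sub>R (x * y)"
    by transfer (simp add: fscale_def mult.assoc iD_ideal.zero)
  show "x * r *\<^sub>R y = r *\<^sub>R (x * y)"
  proof transfer
    fix x y :: iD_free and r
    have "x * fscale r y = fscale r (x * y)"
      unfolding fscale_def by (metis mult.assoc sc)
    then show "x * fscale r y - fscale r (x * y) \<in> iD_ideal" by (simp add: iD_ideal.zero)
  qed
qed

end

lift_definition iD_gen :: "iD_letter \<Rightarrow> iDinf" is fletter .

abbreviation iD_a :: iDinf where "iD_a \<equiv> iD_gen La"
abbreviation iD_b :: iDinf where "iD_b \<equiv> iD_gen Lb"

lemma iD_relations:
  "iD_a * iD_gen La_inv = 1" "iD_gen La_inv * iD_a = 1"
  "iD_b * iD_gen Lb_inv = 1" "iD_gen Lb_inv * iD_b = 1"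
  "iD_b * iD_a * iD_gen Lb_inv = iD_gen La_inv" "iD_b * iD_b = - 1"
  by (transfer; rule iD_ideal.relator; simp add: iD_relators_def)+

text \<open>The underlying vector space is a subspace of a real vector space type; the values of the
  action outside of it are irrelevant. Compatibility of the action of the scalars
  \<open>\<real> \<subseteq> iD\<^sub>\<infinity>\<close> with the given scalar multiplication is the last axiom.\<close>

locale iD_rep =
  fixes V :: "'v::real_vector set" and act :: "iDinf \<Rightarrow> 'v \<Rightarrow> 'v"
  assumes subspace: "subspace V"
    and act_closed: "v \<in> V \<Longrightarrow> act x v \<in> V"
    and act_add_right: "v \<in> V \<Longrightarrow> w \<in> V \<Longrightarrow> act x (v + w) = act x v + act x w"
    and act_add_left: "v \<in> V \<Longrightarrow> act (x + y) v = act x v + act y v"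
    and act_mult: "v \<in> V \<Longrightarrow> act (x * y) v = act x (act y v)"
    and act_one: "v \<in> V \<Longrightarrow> act 1 v = v"
    and act_of_real: "v \<in> V \<Longrightarrow> act (of_real r) v = r *\<^sub>R v"

definition finite_dimensional :: "'v::real_vector set \<Rightarrow> bool"
  where "finite_dimensional V \<longleftrightarrow> (\<exists>B. finite B \<and> span B = V)"

definition iD_subrep :: "'v::real_vector set \<Rightarrow> 'v set \<Rightarrow> (iDinf \<Rightarrow> 'v \<Rightarrow> 'v) \<Rightarrow> bool"
  where "iD_subrep U V act \<longleftrightarrow> U \<subseteq> V \<and> iD_rep U act"

definition indecomposable :: "'v::real_vector set \<Rightarrow> (iDinf \<Rightarrow> 'v \<Rightarrow> 'v) \<Rightarrow> bool"
  where "indecomposable V act \<longleftrightarrow> V \<noteq> {0} \<and>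
    (\<forall>U W. iD_subrep U V act \<and> iD_subrep W V act \<and> U \<inter> W = {0} \<and>
      V = {u + w |u w. u \<in> U \<and> w \<in> W} \<longrightarrow> U = {0} \<or> W = {0})"

definition iD_isomorphic :: "'v::real_vector set \<Rightarrow> (iDinf \<Rightarrow> 'v \<Rightarrow> 'v) \<Rightarrow>
    'w::real_vector set \<Rightarrow> (iDinf \<Rightarrow> 'w \<Rightarrow> 'w) \<Rightarrow> bool"
  where "iD_isomorphic V act V' act' \<longleftrightarrow>
    (\<exists>h. bij_betw h V V' \<and>
      (\<forall>v\<in>V. \<forall>w\<in>V. h (v + w) = h v + h w) \<and>
      (\<forall>r. \<forall>v\<in>V. h (r *\<^sub>R v) = r *\<^sub>R h v) \<and>
      (\<forall>x. \<forall>v\<in>V. h (act x v) = act' x (h v)))"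

instantiation poly :: (real_vector) real_vector
begin

definition scaleR_poly :: "real \<Rightarrow> 'a poly \<Rightarrow> 'a poly"
  where "scaleR_poly r p = map_poly (scaleR r) p"

lemma coeff_scaleR [simp]: "coeff (r *\<^sub>R p) i = r *\<^sub>R coeff p i"
  by (simp add: scaleR_poly_def coeff_map_poly)

instance
  by standard (simp_all add: poly_eq_iff scaleR_add_left scaleR_add_right)

end

lemma scaleR_poly_eq_smult: "r *\<^sub>R (p :: real poly) = smult r p"
  by (simp add: poly_eq_iff)

text \<open>\<open>\<real>[t]/(q)\<close> is modelled on the remainders modulo \<open>q\<close>: the class of \<open>f\<close> is represented by
  \<open>f mod q\<close>, and products are reduced modulo \<open>q\<close>.\<close>

definition poly_quot :: "real poly \<Rightarrow> real poly set"
  where "poly_quot q = range (\<lambda>f. f mod q)"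

definition tpoly :: "real poly" where "tpoly = [:0, 1:]"

definition t_inv :: "real poly \<Rightarrow> real poly"
  where "t_inv q = (THE u. u \<in> poly_quot q \<and> (tpoly * u) mod q = 1 mod q)"

lemma in_poly_quot_iff: "f \<in> poly_quot q \<longleftrightarrow> f mod q = f"
  unfolding poly_quot_def by (auto simp: image_iff intro: exI[of _ f])

lemma poly_quot_class_eq_iff: "f mod q = g mod q \<longleftrightarrow> q dvd f - g" for q :: "real poly"
  by (rule mod_eq_dvd_iff)

lemma t_inv:
  assumes "poly q 0 \<noteq> 0"
  shows "t_inv q \<in> poly_quot q \<and> (tpoly * t_inv q) mod q = 1 mod q"
  unfolding t_inv_def
proof (rule theI')
  obtain c r where q: "q = pCons c r" by (cases q)
  with assms have c: "c \<noteq> 0" by simp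
  define u where "u = smult (- inverse c) r"
  have "tpoly * u - [:1:] = smult (- inverse c) q"
    using c unfolding u_def q tpoly_def by (simp del: pCons_one)
  then have "q dvd tpoly * u - 1"
    by (metis dvd_refl dvd_smult pCons_one)
  then have tu: "(tpoly * u) mod q = 1 mod q"
    by (rule mod_eq_dvd_iff[THEN iffD2])
  then have ex: "u mod q \<in> poly_quot q \<and> (tpoly * (u mod q)) mod q = 1 mod q"
    by (simp add: poly_quot_def mod_mult_right_eq)
  have uniq: "v = u mod q" if v: "v \<in> poly_quot q \<and> (tpoly * v) mod q = 1 mod q" for v
  proof -
    have neutral: "(h * (tpoly * w)) mod q = h mod q" if "(tpoly * w) mod q = 1 mod q" for h w
      using mod_mult_cong[OF refl that, of h] by simp
    have "v mod q = (v * (tpoly * u)) mod q" by (rule neutral[OF tu, symmetric])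
    also have "v * (tpoly * u) = u * (tpoly * v)" by (simp only: ac_simps)
    also have "\<dots> mod q = u mod q" using v by (intro neutral) blast
    finally show ?thesis using v by (simp add: in_poly_quot_iff)
  qed
  show "\<exists>!u. u \<in> poly_quot q \<and> (tpoly * u) mod q = 1 mod q"
    using ex uniq by blast
qed

text \<open>The pair \<open>(f, g)\<close> stands for \<open>f + b g\<close>.\<close>

definition std_space :: "real poly \<Rightarrow> (real poly \<times> real poly) set"
  where "std_space q = poly_quot q \<times> poly_quot q"

fun std_letter :: "real poly \<Rightarrow> iD_letter \<Rightarrow> real poly \<times> real poly \<Rightarrow> real poly \<times> real poly" where
  "std_letter q La (f, g) = ((tpoly * f) mod q, (t_inv q * g) mod q)"
| "std_letter q La_inv (f, g) = ((t_inv q * f) mod q, (tpoly * g) mod q)"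
| "std_letter q Lb (f, g) = (- g, f)"
| "std_letter q Lb_inv (f, g) = (g, - f)"

text \<open>An element of \<open>iD\<^sub>\<infinity>\<close> acts through any noncommutative polynomial representing it; the choice
  made by \<open>rep_iDinf\<close> is immaterial by \<open>std_act_abs\<close> below.\<close>

definition std_act :: "real poly \<Rightarrow> iDinf \<Rightarrow> real poly \<times> real poly \<Rightarrow> real poly \<times> real poly"
  where "std_act q x = free_op (std_letter q) (rep_iDinf x)"

lemma linear_std_letter: "linear (std_letter q l)"
  by (rule linearI; cases l; auto simp: scaleR_poly_eq_smult poly_mod_add_left
      distrib_left mod_smult_left)

lemma subspace_std_space: "subspace (std_space q)"
  by (auto simp: subspace_def std_space_def in_poly_quot_iff poly_mod_add_left
      scaleR_poly_eq_smult mod_smult_left zero_prod_def)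

lemma std_letter_closed: "v \<in> std_space q \<Longrightarrow> std_letter q l v \<in> std_space q"
  by (cases l; cases v) (auto simp: std_space_def in_poly_quot_iff poly_mod_minus_left)

lemma std_relators:
  assumes "poly q 0 \<noteq> 0" "x \<in> iD_relators" "v \<in> std_space q"
  shows "free_op (std_letter q) x v = 0"
proof -
  obtain f g where v: "v = (f, g)" by (cases v)
  with assms have fg: "f mod q = f" "g mod q = g" by (auto simp: std_space_def in_poly_quot_iff)
  have t: "(tpoly * t_inv q) mod q = 1 mod q" using t_inv[OF assms(1)] by blast
  have 1: "(tpoly * (t_inv q * h)) mod q = h mod q" for h
    using mod_mult_cong[OF t refl, of h] by (simp add: mult.assoc)
  have 2: "(t_inv q * (tpoly * h)) mod q = h mod q" for h
    using 1[of h] by (simp add: mult.left_commute)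
  show ?thesis
    using assms(2) fg
    by (auto simp: v iD_relators_def free_op_diff free_op_add free_op_mult[OF linear_std_letter]
        mod_mult_right_eq 1 2 zero_prod_def)
qed

lemma std_act_abs:
  assumes "poly q 0 \<noteq> 0" "v \<in> std_space q"
  shows "std_act q (abs_iDinf x) v = free_op (std_letter q) x v"
proof -
  have "rep_iDinf (abs_iDinf x) - x \<in> iD_ideal"
    using Quotient3_rep_abs[OF Quotient3_iDinf, of x] by (simp add: iD_ideal.zero)
  then have "free_op (std_letter q) (rep_iDinf (abs_iDinf x) - x) v = 0"
    by (rule free_op_ideal[OF linear_std_letter _ assms(2) subspace_std_space])
       (auto intro: std_letter_closed std_relators[OF assms(1)])
  then show ?thesis by (simp add: std_act_def free_op_diff)
qed

lemma std_act_a_b: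
  assumes "poly q 0 \<noteq> 0" "f \<in> poly_quot q" "g \<in> poly_quot q"
  shows "std_act q iD_a (f, g) = ((tpoly * f) mod q, (t_inv q * g) mod q)"
    and "std_act q iD_b (f, g) = (- g, f)"
  using assms by (simp_all add: iD_gen.abs_eq std_act_abs std_space_def)

lemma iD_rep_std:
  assumes "poly q 0 \<noteq> 0"
  shows "iD_rep (std_space q) (std_act q)"
proof
  have closed: "free_op (std_letter q) x v \<in> std_space q" if "v \<in> std_space q" for x v
    by (rule free_op_closed[OF linear_std_letter subspace_std_space std_letter_closed that])
  note abs = std_act_abs[OF assms]
  fix x y :: iDinf and v w and r :: real
  assume v: "v \<in> std_space q"
  obtain x' y' where xy: "x = abs_iDinf x'" "y = abs_iDinf y'"
    by (metis Quotient3_abs_rep[OF Quotient3_iDinf])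
  show "std_act q x v \<in> std_space q" using v by (simp add: xy abs closed)
  show "std_act q (x + y) v = std_act q x v + std_act q y v"
    using v by (simp add: xy plus_iDinf.abs_eq abs free_op_add)
  show "std_act q (x * y) v = std_act q x (std_act q y v)"
    using v by (simp add: xy times_iDinf.abs_eq abs closed free_op_mult[OF linear_std_letter])
  show "std_act q 1 v = v" using v by (simp add: one_iDinf.abs_eq abs)
  show "std_act q (of_real r) v = r *\<^sub>R v"
    using v by (simp add: of_real_def one_iDinf.abs_eq scaleR_iDinf.abs_eq abs
        free_op_fscale[OF linear_std_letter])
  assume "w \<in> std_space q"
  then show "std_act q x (v + w) = std_act q x v + std_act q x w"
    using v by (simp add: std_act_def linear_add[OF linear_free_op[OF linear_std_letter]])
qed (rule subspace_std_space)

definition type1 :: "real poly \<Rightarrow> bool"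
  where "type1 p \<longleftrightarrow> (\<exists>r. r \<noteq> 0 \<and> p = [:- r, 1:])"

definition type2 :: "real poly \<Rightarrow> bool"
  where "type2 p \<longleftrightarrow> (\<exists>c. c \<notin> \<real> \<and> map_poly complex_of_real p = [:- c, 1:] * [:- cnj c, 1:])"

lemma type1_or_2_poly_0:
  assumes "type1 p \<or> type2 p"
  shows "poly (p ^ n) 0 \<noteq> 0"
proof -
  have "coeff p 0 \<noteq> 0" if "c \<notin> \<real>" "map_poly complex_of_real p = [:- c, 1:] * [:- cnj c, 1:]" for c
  proof -
    have "complex_of_real (coeff p 0) = c * cnj c"
      using arg_cong[OF that(2), of "\<lambda>p. coeff p 0"] by (simp add: coeff_map_poly)
    with that(1) show ?thesis by (metis Reals_0 complex_cnj_zero_iff mult_eq_0_iff of_real_0)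
  qed
  then have "coeff p 0 \<noteq> 0"
    using assms unfolding type1_def type2_def by (metis coeff_pCons_0 neg_equal_0_iff_equal)
  then show ?thesis by (simp add: poly_0_coeff_0[symmetric])
qed

end

theory Submission
  imports
    Defs
    "HOL-Computational_Algebra.Field_as_Ring"
    "HOL-Computational_Algebra.Polynomial_Factorial"
    "HOL-Computational_Algebra.Fundamental_Theorem_Algebra"
begin

text \<open>
  Let \<open>p\<close> be the minimal polynomial over \<open>\<real>\<close> of some \<open>c \<noteq> 0\<close> in \<open>\<complex>\<close>; these are exactly the
  polynomials of the two types. Write \<open>S\<close> for the standard representation attached to
  \<open>q = p ^ Suc m\<close>. Both halves of the classification rest on one fact (\<open>socle_in_subrep\<close>): every
  nonzero subrepresentation of \<open>S\<close> contains the vector \<open>(p ^ m, 0)\<close>. Two nonzero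
  subrepresentations therefore meet, and \<open>S\<close> is indecomposable.

  The fact has two cases. If \<open>\<bar>c\<bar> \<noteq> 1\<close>, then \<open>1 / c\<close> is not a root of \<open>p\<close>, so \<open>a\<close> has disjoint
  spectra on the two summands of \<open>S\<close>, and a polynomial in \<open>a\<close> annihilates the second summand while
  staying injective on the first. If \<open>\<bar>c\<bar> = 1\<close>, then \<open>t \<mapsto> t\<^sup>-\<^sup>1\<close> induces complex conjugation on
  \<open>\<real>[t]/(p) = \<real>(c)\<close>. Modulo \<open>p\<close> an element \<open>f + b h\<close> of the algebra then has the positive definite
  norm \<open>\<bar>f(c)\<bar>\<^sup>2 + \<bar>h(c)\<bar>\<^sup>2\<close>, so it is invertible there unless
  \<open>p\<close> divides both \<open>f\<close> and \<open>h\<close>; this is where \<open>b\<^sup>2 = -1\<close> matters.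

  Conversely, let \<open>V\<close> be finite dimensional and nonzero. A nonzero polynomial \<open>f\<close> of
  least degree with \<open>f(a) = 0\<close> on \<open>V\<close> has a complex root \<open>c\<close>, which gives \<open>f = p ^ Suc m * r\<close> with \<open>p\<close> not dividing
  \<open>r\<close>. By minimality there is \<open>v \<in> V\<close> with \<open>p ^ Suc m (a) v = 0\<close> and \<open>p ^ m (a) v \<noteq> 0\<close>
  (\<open>ex_primary_vector\<close>), and coprimality keeps \<open>p ^ m (a) v\<close> outside the image of
  \<open>p ^ Suc m (a)\<close>. So a linear functional \<open>l\<close> exists that vanishes on this image but not at
  \<open>p ^ m (a) v\<close>.

  The subrepresentation generated by \<open>v\<close> is the image of \<open>j : S \<rightarrow> V\<close>, \<open>j (f + b g) = f v + b g v\<close>.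
  A complement is the largest subrepresentation \<open>W\<close> on which \<open>l\<close> vanishes. Indeed \<open>W\<close> is the
  kernel of a linear map \<open>\<Phi> : V \<rightarrow> S\<close> that records the values of \<open>l\<close> at \<open>a ^ i w\<close> and \<open>a ^ i b w\<close>.
  The kernel of \<open>\<Phi> \<circ> j\<close> is a subrepresentation of \<open>S\<close> that misses \<open>(p ^ m, 0)\<close>, so it is zero by
  the fact above; an injective endomorphism of a finite-dimensional space is onto, and
  \<open>V = j S \<oplus> W\<close> follows (\<open>ex_std_direct_summand\<close>). If \<open>V\<close> is indecomposable, then \<open>W = 0\<close> and
  \<open>V\<close> is isomorphic to \<open>S\<close>.
\<close>

section \<open>Polynomials in one element of a real algebra\<close>

text \<open>The algebra may be noncommutative: real coefficients are central, so evaluation at a single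
  element is still a ring homomorphism.\<close>

definition peval :: "real poly \<Rightarrow> 'a \<Rightarrow> 'a::real_algebra_1"
  where "peval f x = fold_coeffs (\<lambda>c y. of_real c + x * y) f 0"

lemma peval_0 [simp]: "peval 0 x = 0"
  by (simp add: peval_def)

lemma peval_pCons [simp]: "peval (pCons c f) x = of_real c + x * peval f x"
  by (cases "c = 0 \<and> f = 0") (auto simp: peval_def)

lemma peval_1 [simp]: "peval 1 x = 1"
  by (simp add: one_pCons)

lemma peval_tpoly [simp]: "peval tpoly x = x"
  by (simp add: tpoly_def)

lemma peval_add [simp]: "peval (f + g) x = peval f x + peval g x"
  by (induction f g rule: poly_induct2) (simp_all add: distrib_left)

lemma peval_smult [simp]: "peval (smult r f) x = r *\<^sub>R peval f x"
  by (induction f) (simp_all add: scaleR_add_right of_real_def)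

lemma peval_minus [simp]: "peval (- f) x = - peval f x"
  using peval_smult[of "-1" f x] by simp

lemma peval_diff [simp]: "peval (f - g) x = peval f x - peval g x"
  using peval_add[of f "- g" x] by simp

lemma peval_mult [simp]: "peval (f * g) x = peval f x * peval g x"
  by (induction f) (simp_all add: distrib_right of_real_def mult.assoc)

lemma peval_power [simp]: "peval (f ^ n) x = peval f x ^ n"
  by (induction n) simp_all

lemma peval_pcompose: "peval (pcompose f u) x = peval f (peval u x)"
  by (induction f) (simp_all add: pcompose_pCons)

text \<open>For \<open>x = a\<close>, \<open>y = a\<^sup>-\<^sup>1\<close> this moves a polynomial in \<open>a\<close> past \<open>b\<close>; for \<open>x = y\<close> it is
  commutation with everything that commutes with \<open>x\<close>.\<close>

lemma peval_intertwine: "x * b = b * y \<Longrightarrow> peval f x * b = b * peval f y"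
proof (induction f)
  case (pCons c f)
  have "x * peval f x * b = x * (peval f x * b)" by (simp add: mult.assoc)
  also have "\<dots> = x * b * peval f y" by (simp add: pCons.IH[OF pCons.prems] mult.assoc)
  also have "\<dots> = b * (y * peval f y)" by (simp add: pCons.prems mult.assoc)
  finally show ?case by (simp add: distrib_left distrib_right of_real_def)
qed simp

lemma peval_commute: "peval f x * peval g x = peval g x * peval f x"
  by (metis mult.commute peval_mult)

lemma peval_eq_sum:
  assumes "degree f < N"
  shows "peval f x = (\<Sum>i<N. coeff f i *\<^sub>R x ^ i)"
  using assms
proof (induction f arbitrary: N)
  case (pCons c f)
  then obtain M where M: "N = Suc M" by (cases N) auto
  show ?case
  proof (cases "f = 0")
    case True
    then show ?thesis unfolding M sum.lessThan_Suc_shift by (simp add: of_real_def)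
  next
    case False
    then have "degree f < M" using pCons M by simp
    then show ?thesis
      unfolding M sum.lessThan_Suc_shift
      by (simp add: pCons.IH sum_distrib_left of_real_def)
  qed
qed simp

lemma peval_cnj: "peval f (cnj c) = cnj (peval f c)"
  by (induction f) simp_all

lemma peval_complex: "peval f c = poly (map_poly complex_of_real f) c"
  by (induction f) (simp_all add: map_poly_pCons)

section \<open>Real minimal polynomials of complex numbers\<close>

text \<open>Being a generator of the kernel of evaluation at \<open>c\<close> is what all arguments use: each
  divisibility by \<open>p\<close> becomes a vanishing condition at the complex number \<open>c\<close>. It fixes \<open>p\<close> only
  up to a scalar factor.\<close>

definition real_minpoly :: "real poly \<Rightarrow> complex \<Rightarrow> bool"
  where "real_minpoly p c \<longleftrightarrow> (\<forall>f. p dvd f \<longleftrightarrow> peval f c = 0)"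

lemma real_minpolyD: "real_minpoly p c \<Longrightarrow> p dvd f \<longleftrightarrow> peval f c = 0"
  by (simp add: real_minpoly_def)

text \<open>The real polynomial with the roots \<open>c\<close> and \<open>cnj c\<close>. For non-real \<open>c\<close> it is a polynomial of the
  second type; for arbitrary \<open>c\<close> it is a real polynomial vanishing at \<open>c\<close>.\<close>

definition conj_quadratic :: "complex \<Rightarrow> real poly"
  where "conj_quadratic c = [:(cmod c)\<^sup>2, - 2 * Re c, 1:]"

lemma map_conj_quadratic:
  "map_poly complex_of_real (conj_quadratic c) = [:- c, 1:] * [:- cnj c, 1:]"
  by (simp add: conj_quadratic_def map_poly_pCons complex_eq_iff cmod_power2)
     (simp add: power2_eq_square)

lemma peval_conj_quadratic: "peval (conj_quadratic c) z = (z - c) * (z - cnj c)"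
  unfolding peval_complex map_conj_quadratic by (simp add: algebra_simps)

lemma conj_quadratic_nonzero: "conj_quadratic c \<noteq> 0"
  by (simp add: conj_quadratic_def)

lemma real_minpoly_linear: "real_minpoly [:- r, 1:] (complex_of_real r)"
proof -
  have "peval f (complex_of_real r) = complex_of_real (poly f r)" for f
    by (induction f) simp_all
  then show ?thesis by (simp add: real_minpoly_def poly_eq_0_iff_dvd)
qed

text \<open>A remainder of degree at most one that vanishes at a non-real number has coefficients zero,
  because its imaginary part isolates the leading one.\<close>

lemma real_minpoly_conj_quadratic:
  assumes "c \<notin> \<real>"
  shows "real_minpoly (conj_quadratic c) c"
  unfolding real_minpoly_def
proof (intro allI iffI)
  fix f assume "conj_quadratic c dvd f"
  then show "peval f c = 0" by (auto simp: peval_conj_quadratic elim!: dvdE)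
next
  fix f assume f: "peval f c = 0"
  let ?Q = "conj_quadratic c"
  define r where "r = f mod ?Q"
  have "f = f div ?Q * ?Q + r" by (simp add: r_def)
  then have "peval f c = peval (f div ?Q * ?Q) c + peval r c" by (metis peval_add)
  then have r0: "peval r c = 0" using f by (simp add: peval_conj_quadratic)
  have "degree r < 2 \<or> r = 0"
    using degree_mod_less[of ?Q f] conj_quadratic_nonzero by (auto simp: r_def conj_quadratic_def)
  then have "degree r < 2" by auto
  then have eq: "coeff r 0 + coeff r 1 * c = 0"
    using r0 peval_eq_sum[of r 2 c] by (simp add: numeral_2_eq_2 scaleR_conv_of_real)
  have "Im c \<noteq> 0" using assms by (simp add: complex_is_Real_iff)
  with arg_cong[OF eq, of Im] have "coeff r 1 = 0" by simp
  with eq have "coeff r 0 = 0" by simp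
  have "r = 0"
  proof (rule poly_eqI)
    fix i show "coeff r i = coeff 0 i"
      using \<open>degree r < 2\<close> \<open>coeff r 0 = 0\<close> \<open>coeff r 1 = 0\<close>
      by (cases "i = 0"; cases "i = 1") (auto intro: coeff_eq_0)
  qed
  then show "?Q dvd f" by (simp add: r_def mod_eq_0_iff_dvd)
qed

lemma type1_or_2_imp_real_minpoly:
  assumes "type1 p \<or> type2 p"
  obtains c where "c \<noteq> 0" "real_minpoly p c"
  using assms
proof
  assume "type1 p"
  then obtain r where "r \<noteq> 0" "p = [:- r, 1:]" by (auto simp: type1_def)
  then show thesis using that[of "complex_of_real r"] real_minpoly_linear by simp
next
  assume "type2 p"
  then obtain c where c: "c \<notin> \<real>" "map_poly complex_of_real p = map_poly complex_of_real (conj_quadratic c)"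
    unfolding type2_def map_conj_quadratic by blast
  then have "p = conj_quadratic c"
    by (simp add: poly_eq_iff coeff_map_poly)
  moreover have "c \<noteq> 0" using c(1) by auto
  ultimately show thesis using that[of c] c(1) real_minpoly_conj_quadratic by auto
qed

lemma ex_real_minpoly:
  assumes "c \<noteq> 0"
  obtains p where "type1 p \<or> type2 p" "real_minpoly p c"
proof (cases "c \<in> \<real>")
  case True
  then obtain r where "c = of_real r" by (rule Reals_cases)
  with assms show ?thesis using that[of "[:- r, 1:]"] real_minpoly_linear[of r]
    unfolding type1_def by simp
next
  case False
  then have "type2 (conj_quadratic c)" using map_conj_quadratic unfolding type2_def by blast
  with False show ?thesis using that real_minpoly_conj_quadratic by blast
qed

lemma real_minpoly_nonzero:
  assumes "real_minpoly p c"
  shows "p \<noteq> 0"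
proof
  assume "p = 0"
  moreover have "p dvd conj_quadratic c"
    using assms by (simp add: real_minpolyD peval_conj_quadratic)
  ultimately show False using conj_quadratic_nonzero by simp
qed

text \<open>The kernel of a homomorphism into a field is a prime ideal.\<close>

lemma real_minpoly_prime_elem:
  assumes "real_minpoly p c"
  shows "prime_elem p"
  using real_minpoly_nonzero[OF assms] by (intro prime_elemI) (simp_all add: real_minpolyD[OF assms])

lemma real_minpoly_degree_pos:
  assumes "real_minpoly p c"
  shows "0 < degree p"
proof (rule ccontr)
  assume "\<not> 0 < degree p"
  then obtain k where k: "p = [:k:]" using degree_eq_zeroE by blast
  have "peval p c = 0" using real_minpolyD[OF assms, of p] by simp
  then show False using k real_minpoly_nonzero[OF assms] by simp
qed

text \<open>If \<open>t\<close> divided \<open>p\<close>, the cofactor would vanish at \<open>c\<close> too, yet have smaller degree than \<open>p\<close>.\<close>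

lemma real_minpoly_poly_0:
  assumes "c \<noteq> 0" "real_minpoly p c"
  shows "poly p 0 \<noteq> 0"
proof
  assume "poly p 0 = 0"
  then obtain k where k: "p = pCons 0 k" by (cases p) simp
  then have "k \<noteq> 0" using real_minpoly_nonzero[OF assms(2)] by auto
  have "peval p c = 0" using real_minpolyD[OF assms(2), of p] by simp
  then have "p dvd k" using assms(1) real_minpolyD[OF assms(2), of k] by (simp add: k)
  then have "degree p \<le> degree k" using \<open>k \<noteq> 0\<close> by (rule dvd_imp_degree_le)
  then show False using \<open>k \<noteq> 0\<close> by (simp add: k)
qed

lemma real_minpoly_power_mod:
  assumes "real_minpoly p c"
  shows "p ^ m mod p ^ Suc m = p ^ m"
  using real_minpoly_degree_pos[OF assms] real_minpoly_nonzero[OF assms]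
  by (intro mod_poly_less) (simp add: degree_power_eq degree_mult_eq)

lemma real_minpoly_coprime:
  "real_minpoly p c \<Longrightarrow> \<not> p dvd f \<Longrightarrow> coprime p f"
  by (intro prime_elem_imp_coprime real_minpoly_prime_elem)

lemma coprime_poly_bezout:
  fixes f g :: "real poly"
  assumes "coprime f g"
  obtains x y where "x * f + y * g = 1"
  using bezout_coefficients_fst_snd[of f g] assms by (auto simp: coprime_iff_gcd_eq_1)

section \<open>The algebra \<open>iD\<^sub>\<infinity>\<close>\<close>

text \<open>This replaces a normal form for elements of \<open>iD\<^sub>\<infinity>\<close>: closure of a subspace under the action and compatibility
  of a map with it need only be checked on the generators.\<close>

lemma iDinf_induct [case_names of_real gen add mult]:
  assumes "\<And>r. P (of_real r)" "\<And>l. P (iD_gen l)"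
    and "\<And>x y. P x \<Longrightarrow> P y \<Longrightarrow> P (x + y)" and mult: "\<And>x y. P x \<Longrightarrow> P y \<Longrightarrow> P (x * y)"
  shows "P x"
proof -
  have word: "P (abs_iDinf (Poly_Mapping.single (Word ls) 1))" for ls
  proof (induction ls)
    case Nil
    have "abs_iDinf (Poly_Mapping.single (Word []) 1) = of_real 1"
      by (simp add: one_iDinf.abs_eq flip: zero_iD_word_def)
    then show ?case by (metis assms(1))
  next
    case (Cons l ls)
    have "Poly_Mapping.single (Word (l # ls)) (1::real) = fletter l * Poly_Mapping.single (Word ls) 1"
      by (simp add: fletter_def mult_single plus_iD_word_def)
    then have "abs_iDinf (Poly_Mapping.single (Word (l # ls)) 1) =
        iD_gen l * abs_iDinf (Poly_Mapping.single (Word ls) 1)"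
      by (simp add: iD_gen.abs_eq times_iDinf.abs_eq)
    then show ?case using Cons by (simp add: mult assms(2))
  qed
  have "P (abs_iDinf y)" for y
  proof (induction y rule: iD_free_induct)
    case zero
    then show ?case using assms(1)[of 0] by (simp add: zero_iDinf.abs_eq)
  next
    case (single w c)
    have "abs_iDinf (Poly_Mapping.single w c) = of_real c * abs_iDinf (Poly_Mapping.single w 1)"
      by (simp add: of_real_def one_iDinf.abs_eq scaleR_iDinf.abs_eq times_iDinf.abs_eq
          fscale_def mult_single)
    moreover have "P (abs_iDinf (Poly_Mapping.single w 1))" using word by (cases w) simp
    ultimately show ?case by (simp add: mult assms(1))
  next
    case (add x y)
    then show ?case using assms(3) by (simp flip: plus_iDinf.abs_eq)
  qed
  then show ?thesis by (metis Quotient3_abs_rep[OF Quotient3_iDinf])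
qed

abbreviation iD_a_inv :: iDinf where "iD_a_inv \<equiv> iD_gen La_inv"

lemma iD_b_inv: "iD_gen Lb_inv = - iD_b"
proof -
  have "- iD_gen Lb_inv = (iD_b * iD_b) * iD_gen Lb_inv" by (subst iD_relations(6)) simp
  also have "\<dots> = iD_b" by (simp only: mult.assoc iD_relations(3) mult_1_right)
  finally show ?thesis by (metis minus_minus)
qed

lemma iD_b_a: "iD_b * iD_a = iD_a_inv * iD_b"
proof -
  have "iD_a_inv * iD_b = iD_b * iD_a * iD_gen Lb_inv * iD_b"
    by (simp only: iD_relations)
  also have "\<dots> = iD_b * iD_a * (iD_gen Lb_inv * iD_b)" by (simp only: mult.assoc)
  finally show ?thesis by (simp add: iD_relations)
qed

lemma iD_a_b: "iD_a * iD_b = iD_b * iD_a_inv"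
proof -
  have "iD_a * iD_b = iD_a * (iD_b * iD_a) * iD_a_inv" by (simp add: iD_relations mult.assoc)
  also have "\<dots> = (iD_a * iD_a_inv) * iD_b * iD_a_inv" by (simp only: iD_b_a mult.assoc)
  finally show ?thesis by (simp add: iD_relations)
qed

lemma peval_a_a_inv: "peval f iD_a * iD_a_inv = iD_a_inv * peval f iD_a"
  by (rule peval_intertwine) (simp add: iD_relations)

section \<open>Representations, subrepresentations and intertwiners\<close>

context iD_rep
begin

lemma zero_in: "0 \<in> V" by (rule subspace_0[OF subspace])

lemma act_zero_left [simp]: "v \<in> V \<Longrightarrow> act 0 v = 0"
  using act_of_real[of v 0] by simp

lemma act_scaleR_left: "v \<in> V \<Longrightarrow> act (r *\<^sub>R x) v = r *\<^sub>R act x v"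
  using act_mult[of v "of_real r" x] act_of_real[of "act x v" r] act_closed
  by (simp add: of_real_def)

lemma act_minus_left: "v \<in> V \<Longrightarrow> act (- x) v = - act x v"
  using act_scaleR_left[of v "-1" x] by simp

lemma act_diff_left: "v \<in> V \<Longrightarrow> act (x - y) v = act x v - act y v"
  using act_add_left[of v x "- y"] by (simp add: act_minus_left)

lemma act_scaleR_right: "v \<in> V \<Longrightarrow> act x (r *\<^sub>R v) = r *\<^sub>R act x v"
proof -
  assume v: "v \<in> V"
  then have "act x (r *\<^sub>R v) = act (x * of_real r) v" by (simp add: act_mult act_of_real)
  also have "x * of_real r = r *\<^sub>R x" by (simp add: of_real_def)
  finally show ?thesis using v by (simp add: act_scaleR_left)
qed

lemma act_zero_right [simp]: "act x 0 = 0"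
  using act_scaleR_right[OF zero_in, of x 0] by simp

lemma act_minus_right: "v \<in> V \<Longrightarrow> act x (- v) = - act x v"
  using act_scaleR_right[of v x "-1"] by simp

lemma act_sum_left: "v \<in> V \<Longrightarrow> act (\<Sum>i\<in>I. x i) v = (\<Sum>i\<in>I. act (x i) v)"
  by (induction I rule: infinite_finite_induct) (simp_all add: act_add_left)

lemma subrep_iff:
  "iD_subrep U V act \<longleftrightarrow> U \<subseteq> V \<and> subspace U \<and> (\<forall>x. \<forall>u\<in>U. act x u \<in> U)"
proof
  assume "iD_subrep U V act"
  then show "U \<subseteq> V \<and> subspace U \<and> (\<forall>x. \<forall>u\<in>U. act x u \<in> U)"
    unfolding iD_subrep_def by (metis iD_rep.subspace iD_rep.act_closed)
next
  assume U: "U \<subseteq> V \<and> subspace U \<and> (\<forall>x. \<forall>u\<in>U. act x u \<in> U)"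
  then have "u \<in> V" if "u \<in> U" for u using that by blast
  then have "iD_rep U act"
    using U
    by unfold_locales (simp_all add: act_add_right act_add_left act_mult act_one act_of_real)
  then show "iD_subrep U V act" using U by (simp add: iD_subrep_def)
qed

lemma subrepI:
  assumes "U \<subseteq> V" "subspace U"
    and "\<And>u. u \<in> U \<Longrightarrow> act iD_a u \<in> U" "\<And>u. u \<in> U \<Longrightarrow> act iD_a_inv u \<in> U"
    and b: "\<And>u. u \<in> U \<Longrightarrow> act iD_b u \<in> U"
  shows "iD_subrep U V act"
  unfolding subrep_iff
proof (intro conjI allI)
  fix x show "\<forall>u\<in>U. act x u \<in> U"
  proof (induction x rule: iDinf_induct)
    case (gen l)
    have "act (iD_gen Lb_inv) u \<in> U" if "u \<in> U" for u
      using b[OF that] that assms(1) subspace_neg[OF assms(2)] by (auto simp: iD_b_inv act_minus_left)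
    with assms show ?case by (cases l) auto
  qed (use assms(1,2) in \<open>auto simp: act_of_real act_add_left act_mult subset_iff
         intro: subspace_scale subspace_add\<close>)
qed (use assms in auto)

end

text \<open>The inverses of \<open>a\<close> and \<open>b\<close> come for free: \<open>a\<close> is bijective on both sides, and \<open>b\<^sup>-\<^sup>1 = - b\<close>.\<close>

lemma intertwinerI:
  assumes V: "iD_rep V act" and V': "iD_rep V' act'"
    and h: "\<And>v. v \<in> V \<Longrightarrow> h v \<in> V'"
    and add: "\<And>v w. v \<in> V \<Longrightarrow> w \<in> V \<Longrightarrow> h (v + w) = h v + h w"
    and scale: "\<And>r v. v \<in> V \<Longrightarrow> h (r *\<^sub>R v) = r *\<^sub>R h v"
    and a: "\<And>v. v \<in> V \<Longrightarrow> h (act iD_a v) = act' iD_a (h v)"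
    and b: "\<And>v. v \<in> V \<Longrightarrow> h (act iD_b v) = act' iD_b (h v)"
    and v: "v \<in> V"
  shows "h (act x v) = act' x (h v)"
proof -
  interpret V: iD_rep V act by (rule V)
  interpret V': iD_rep V' act' by (rule V')
  have "\<forall>v\<in>V. h (act x v) = act' x (h v)"
  proof (induction x rule: iDinf_induct)
    case (gen l)
    have "h (act iD_a_inv v) = act' iD_a_inv (h v)" if v: "v \<in> V" for v
    proof -
      have "act' iD_a_inv (h (act (iD_a * iD_a_inv) v)) = act' (iD_a_inv * iD_a) (h (act iD_a_inv v))"
        using v by (simp add: V.act_mult V'.act_mult V.act_closed a h)
      then show ?thesis using v by (simp add: iD_relations V.act_one V'.act_one V.act_closed h)
    qed
    moreover have "h (- act iD_b v) = - act' iD_b (h v)" if "v \<in> V" for v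
      using scale[of "act iD_b v" "-1"] that by (simp add: V.act_closed b)
    ultimately show ?case
      using a b by (cases l) (simp_all add: iD_b_inv V.act_minus_left V'.act_minus_left h)
  qed (simp_all add: V.act_of_real V'.act_of_real h scale V.act_add_left V'.act_add_left add
        V.act_closed V.act_mult V'.act_mult)
  with v show ?thesis by blast
qed

section \<open>The socle of a standard representation\<close>

lemma in_poly_quot_iff_degree:
  "q \<noteq> 0 \<Longrightarrow> f \<in> poly_quot q \<longleftrightarrow> f = 0 \<or> degree f < degree q"
  unfolding in_poly_quot_iff by (metis degree_mod_less mod_poly_less mod_0)

lemma finite_dimensional_std_space:
  assumes "q \<noteq> 0"
  shows "finite_dimensional (std_space q)"
  unfolding finite_dimensional_def
proof (intro exI conjI)
  let ?N = "degree q"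
  let ?B1 = "(\<lambda>i. (monom 1 i, 0)) ` {..<?N}" and ?B2 = "(\<lambda>i. (0, monom 1 i)) ` {..<?N}"
  let ?B = "?B1 \<union> ?B2 :: (real poly \<times> real poly) set"
  show "finite ?B" by simp
  show "span ?B = std_space q"
  proof
    show "span ?B \<subseteq> std_space q"
      by (rule span_minimal[OF _ subspace_std_space])
        (auto simp: std_space_def in_poly_quot_iff_degree[OF assms] degree_monom_eq)
    show "std_space q \<subseteq> span ?B"
    proof
      fix w assume "w \<in> std_space q"
      then obtain f g where w: "w = (f, g)" and fg: "f \<in> poly_quot q" "g \<in> poly_quot q"
        by (auto simp: std_space_def)
      have sum: "h = (\<Sum>i<?N. coeff h i *\<^sub>R monom 1 i)" if "h \<in> poly_quot q" for h :: "real poly"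
      proof (rule poly_eqI)
        fix k
        have "coeff h k = 0" if "\<not> k < ?N"
          using that \<open>h \<in> poly_quot q\<close> by (auto simp: in_poly_quot_iff_degree[OF assms] coeff_eq_0)
        then show "coeff h k = coeff (\<Sum>i<?N. coeff h i *\<^sub>R monom 1 i) k"
          by (auto simp: coeff_sum if_distrib[of "(*) _"] cong: if_cong)
      qed
      have "w = (\<Sum>i<?N. coeff f i *\<^sub>R (monom 1 i, 0)) + (\<Sum>i<?N. coeff g i *\<^sub>R (0, monom 1 i))"
        using sum[OF fg(1)] sum[OF fg(2)] by (simp add: w prod_eq_iff fst_sum snd_sum)
      also have "\<dots> \<in> span ?B"
        by (intro span_add span_sum span_scale span_base) auto
      finally show "w \<in> span ?B" .
    qed
  qed
qed

text \<open>On the second summand \<open>a\<close> acts as \<open>t\<^sup>-\<^sup>1\<close>, so a polynomial \<open>h\<close> in \<open>a\<close> acts there as its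
  composition with the polynomial \<open>t_inv q\<close> representing \<open>t\<^sup>-\<^sup>1\<close>.\<close>

lemma std_act_peval:
  assumes q: "poly q 0 \<noteq> 0" and fg: "f \<in> poly_quot q" "g \<in> poly_quot q"
  shows "std_act q (peval h iD_a) (f, g) = ((h * f) mod q, (pcompose h (t_inv q) * g) mod q)"
proof (induction h)
  case 0
  interpret iD_rep "std_space q" "std_act q" by (rule iD_rep_std[OF q])
  show ?case using fg act_zero_left[of "(f, g)"] by (simp add: std_space_def zero_prod_def)
next
  case (pCons c h)
  interpret iD_rep "std_space q" "std_act q" by (rule iD_rep_std[OF q])
  have v: "(f, g) \<in> std_space q" using fg by (simp add: std_space_def)
  have *: "c *\<^sub>R k = smult c k mod q" if "k \<in> poly_quot q" for k
    using that by (simp add: in_poly_quot_iff scaleR_poly_eq_smult mod_smult_left)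
  have t: "pCons 0 k = tpoly * k" for k by (simp add: tpoly_def)
  have "std_act q (peval (pCons c h) iD_a) (f, g) =
      c *\<^sub>R (f, g) + std_act q iD_a (std_act q (peval h iD_a) (f, g))"
    using v by (simp add: act_add_left act_mult act_of_real)
  also have "\<dots> = c *\<^sub>R (f, g) +
      ((tpoly * (h * f)) mod q, (t_inv q * (pcompose h (t_inv q) * g)) mod q)"
    by (simp add: pCons.IH std_act_a_b[OF q] poly_quot_def mod_mult_right_eq)
  also have "\<dots> = ((pCons c h * f) mod q, (pcompose (pCons c h) (t_inv q) * g) mod q)"
    using fg by (simp add: * pcompose_pCons t poly_mod_add_left distrib_right mult.assoc)
  finally show ?case .
qed

lemma pcompose_power_left: "pcompose (f ^ n) u = pcompose f u ^ n"
  by (induction n) (simp_all add: pcompose_mult one_pCons)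

text \<open>Evaluation at \<open>c\<close> factors through \<open>\<real>[t]/(p ^ Suc m)\<close>, where \<open>t_inv\<close> is the inverse of \<open>t\<close>.\<close>

lemma peval_t_inv:
  assumes "c \<noteq> 0" "real_minpoly p c"
  shows "peval (t_inv (p ^ Suc m)) c = inverse c"
proof -
  have "poly (p ^ Suc m) 0 \<noteq> 0" using real_minpoly_poly_0[OF assms] by simp
  then have "p ^ Suc m dvd tpoly * t_inv (p ^ Suc m) - 1"
    unfolding poly_quot_class_eq_iff[symmetric] using t_inv by blast
  then have "p dvd tpoly * t_inv (p ^ Suc m) - 1"
    by (meson dvd_power dvd_trans zero_less_Suc)
  then have "c * peval (t_inv (p ^ Suc m)) c = 1" by (simp add: real_minpolyD[OF assms(2)])
  then show ?thesis using assms(1) by (metis inverse_unique)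
qed

text \<open>The vector \<open>(p ^ m, 0)\<close> lies in every nonzero subrepresentation \<open>U\<close>. It suffices to find in \<open>U\<close>
  some \<open>(p ^ m * F, 0)\<close> with \<open>F\<close> prime to \<open>p\<close>, since \<open>F\<close> can then be inverted modulo \<open>p\<close> by a
  polynomial in \<open>a\<close>. How the second coordinate is removed depends on whether \<open>p\<close> vanishes at
  \<open>1 / c\<close>, that is, on whether \<open>\<bar>c\<bar> = 1\<close>.\<close>

lemma socle_in_subrep:
  assumes c0: "c \<noteq> 0" and mp: "real_minpoly p c"
    and U: "iD_subrep U (std_space (p ^ Suc m)) (std_act (p ^ Suc m))" and "U \<noteq> {0}"
  shows "(p ^ m, 0) \<in> U"
proof -
  define q where "q = p ^ Suc m"
  define u where "u = t_inv q"
  have q0: "poly q 0 \<noteq> 0" using real_minpoly_poly_0[OF c0 mp] by (simp add: q_def)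
  interpret iD_rep "std_space q" "std_act q" by (rule iD_rep_std[OF q0])
  have Usub: "U \<subseteq> std_space q" and "subspace U" and Uact: "\<And>x w. w \<in> U \<Longrightarrow> std_act q x w \<in> U"
    using U subrep_iff[of U] by (auto simp: q_def)
  have quot: "f mod q = f" "g mod q = g" "f \<in> poly_quot q" "g \<in> poly_quot q" if "(f, g) \<in> U" for f g
    using that Usub by (auto simp: std_space_def in_poly_quot_iff)
  have bU: "(- g, f) \<in> U" if "(f, g) \<in> U" for f g
    using Uact[OF that, of iD_b] quot[OF that] by (simp add: std_act_a_b[OF q0])
  have hU: "((h * f) mod q, (pcompose h u * g) mod q) \<in> U" if "(f, g) \<in> U" for f g h
    using Uact[OF that, of "peval h iD_a"] quot[OF that] by (simp add: std_act_peval[OF q0] u_def)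
  have addU: "(f + f', g + g') \<in> U" if "(f, g) \<in> U" "(f', g') \<in> U" for f g f' g'
    using subspace_add[OF \<open>subspace U\<close> that] by simp
  have nonzero: thesis if "\<And>f g. (f, g) \<in> U \<Longrightarrow> (f, g) \<noteq> 0 \<Longrightarrow> thesis" for thesis
  proof -
    obtain w where "w \<in> U" "w \<noteq> 0" using \<open>U \<noteq> {0}\<close> subspace_0[OF \<open>subspace U\<close>] by blast
    then show thesis using that by (cases w) simp
  qed
  note p_dvd_iff = real_minpolyD[OF mp]
  have q_dvd: "q dvd p ^ m * f \<longleftrightarrow> p dvd f" for f
    using real_minpoly_nonzero[OF mp] unfolding q_def power_Suc2 by (simp add: dvd_mult_cancel_left)
  have uc: "peval u c = inverse c" unfolding u_def q_def by (rule peval_t_inv[OF c0 mp])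

  have "\<exists>F. \<not> p dvd F \<and> ((p ^ m * F) mod q, 0) \<in> U"
  proof (cases "cmod c = 1")
    case False
    \<comment> \<open>This polynomial in \<open>a\<close> kills the second coordinate, and it is nonzero at
      \<open>c\<close> as \<open>1 / c\<close> and its conjugate differ from \<open>c\<close>.\<close>
    define h where "h = conj_quadratic (inverse c) ^ Suc m"
    have "p dvd pcompose (conj_quadratic (inverse c)) u"
      by (simp add: p_dvd_iff peval_pcompose uc peval_conj_quadratic)
    then have "q dvd pcompose h u"
      unfolding h_def pcompose_power_left q_def by (rule dvd_power_same)
    then have hu: "(pcompose h u * g) mod q = 0" for g by (simp add: mod_eq_0_iff_dvd)
    have norm: "(cmod c)\<^sup>2 \<noteq> 1"
      using False norm_ge_zero[of c] unfolding power2_eq_1_iff by linarith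
    have "c - inverse c \<noteq> 0"
    proof
      assume "c - inverse c = 0"
      then have "c * c = 1" using c0 by (metis eq_iff_diff_eq_0 right_inverse)
      then have "cmod (c * c) = 1" by simp
      then show False using norm by (simp add: norm_mult power2_eq_square)
    qed
    moreover have "c - cnj (inverse c) \<noteq> 0"
    proof
      assume "c - cnj (inverse c) = 0"
      then have "cnj c * c = cnj (c * inverse c)" by simp
      then have "complex_of_real ((cmod c)\<^sup>2) = 1"
        using c0 by (simp only: complex_norm_square) (simp add: mult.commute)
      then show False using norm by (simp only: of_real_eq_1_iff)
    qed
    ultimately have "\<not> p dvd conj_quadratic (inverse c)"
      by (simp add: p_dvd_iff peval_conj_quadratic)
    then have "\<not> p dvd h"
      unfolding h_def using prime_elem_dvd_power[OF real_minpoly_prime_elem[OF mp]] by blast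
    obtain f g where fg: "(f, g) \<in> U" "f \<noteq> 0"
    proof -
      obtain f g where "(f, g) \<in> U" "(f, g) \<noteq> 0" by (rule nonzero)
      then show thesis using that bU[of f g] by (cases "f = 0") (auto simp: zero_prod_def)
    qed
    obtain k f' where f': "f = p ^ k * f'" "\<not> p dvd f'"
      using multiplicity_decompose'[OF fg(2) prime_elem_not_unit[OF real_minpoly_prime_elem[OF mp]]]
      by blast
    have "k \<le> m"
    proof (rule ccontr)
      assume "\<not> k \<le> m"
      then have "q dvd f" unfolding q_def f' by (intro dvd_mult2 le_imp_power_dvd) simp
      then show False using quot(1)[OF fg(1)] fg(2) by auto
    qed
    have "((h * f) mod q, 0) \<in> U" using hU[OF fg(1), of h] by (simp only: hu)
    then have "((p ^ (m - k) * ((h * f) mod q)) mod q, 0) \<in> U" using hU[of _ 0] by fastforce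
    also have "(p ^ (m - k) * ((h * f) mod q)) mod q = (p ^ (m - k) * p ^ k * (h * f')) mod q"
      by (simp add: mod_mult_right_eq f' mult_ac)
    also have "p ^ (m - k) * p ^ k = p ^ m" using \<open>k \<le> m\<close> by (simp flip: power_add)
    finally show ?thesis
      using \<open>\<not> p dvd h\<close> f'(2) prime_elem_dvd_mult_iff[OF real_minpoly_prime_elem[OF mp]] by blast
  next
    case True
    \<comment> \<open>\<open>t_inv\<close> now acts on \<open>\<real>(c)\<close> as complex conjugation, an
      involution.\<close>
    then have uc: "peval u c = cnj c"
      using uc complex_norm_square[of c] inverse_unique[of c "cnj c"] by simp
    then have ucc: "peval u (cnj c) = c" by (simp add: peval_cnj)
    have step: "\<exists>F. \<not> p dvd F \<and> ((p ^ m * F) mod q, 0) \<in> U"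
      if fg: "(p ^ k * f, p ^ k * g) \<in> U" "k \<le> m" "\<not> p dvd f" for f g k
    proof -
      have "p dvd pcompose p u"
        using p_dvd_iff[of p] by (simp add: p_dvd_iff peval_pcompose uc peval_cnj)
      then obtain w where w: "pcompose p u = p * w" by (elim dvdE)
      define H where "H = w ^ (m - k) * g"
      have pm: "p ^ (m - k) * p ^ k = p ^ m" using \<open>k \<le> m\<close> by (simp flip: power_add)
      have "p ^ (m - k) * (p ^ k * f) = p ^ m * f"
        by (simp flip: pm)
      moreover have "pcompose (p ^ (m - k)) u * (p ^ k * g) = p ^ m * H"
        unfolding pcompose_power_left w H_def power_mult_distrib by (simp flip: pm add: mult_ac)
      ultimately have v: "((p ^ m * f) mod q, (p ^ m * H) mod q) \<in> U"
        using hU[OF fg(1), of "p ^ (m - k)"] by (simp only:)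
      \<comment> \<open>Multiplying \<open>f + b H\<close> on the left by \<open>pcompose f u - b H\<close>, its
        quaternionic conjugate, leaves the norm \<open>F\<close> in the first coordinate and zero in the
        second.\<close>
      define F where "F = f * pcompose f u + H * pcompose H u"
      let ?f = "(p ^ m * f) mod q" and ?H = "(p ^ m * H) mod q"
      let ?x = "pcompose f u"
      have "((?x * ?f) mod q, (pcompose ?x u * ?H) mod q) \<in> U" by (rule hU[OF v])
      moreover have "(- ((pcompose (- H) u * ?H) mod q), (- H * ?f) mod q) \<in> U"
        by (intro bU hU v)
      ultimately have "((?x * ?f) mod q - (pcompose (- H) u * ?H) mod q,
          (pcompose ?x u * ?H) mod q + (- H * ?f) mod q) \<in> U"
        using addU by fastforce
      also have "(?x * ?f) mod q - (pcompose (- H) u * ?H) mod q = (p ^ m * F) mod q"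
        by (simp add: mod_mult_right_eq F_def pcompose_uminus poly_mod_minus_left
            distrib_left mult_ac flip: poly_mod_add_left)
      also have "(pcompose ?x u * ?H) mod q + (- H * ?f) mod q =
          (p ^ m * (H * (pcompose ?x u - f))) mod q"
        by (simp only: mod_mult_right_eq flip: poly_mod_add_left) (simp add: algebra_simps)
      also have "\<dots> = 0"
        by (simp only: mod_eq_0_iff_dvd q_dvd) (simp add: p_dvd_iff peval_pcompose uc ucc)
      finally have "((p ^ m * F) mod q, 0) \<in> U" .
      moreover have "\<not> p dvd F"
      proof
        assume "p dvd F"
        then have "peval f c * cnj (peval f c) + peval H c * cnj (peval H c) = 0"
          by (simp add: p_dvd_iff F_def peval_pcompose uc peval_cnj)
        then have "complex_of_real ((cmod (peval f c))\<^sup>2 + (cmod (peval H c))\<^sup>2) = 0"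
          by (simp only: of_real_add complex_norm_square)
        then have "(cmod (peval f c))\<^sup>2 + (cmod (peval H c))\<^sup>2 = 0"
          by (simp only: of_real_eq_0_iff)
        then have "peval f c = 0" by (simp add: sum_power2_eq_zero_iff)
        with fg(3) show False by (simp add: p_dvd_iff)
      qed
      ultimately show ?thesis by blast
    qed
    obtain f g where fg: "(f, g) \<in> U" "(f, g) \<noteq> 0" by (rule nonzero)
    have "\<not> (p ^ Suc m dvd f \<and> p ^ Suc m dvd g)"
      using quot[OF fg(1)] fg(2) unfolding q_def[symmetric] by (auto simp: zero_prod_def)
    \<comment> \<open>Here \<open>k\<close> is the largest exponent with \<open>p ^ k\<close> dividing both
      coordinates; applying \<open>b\<close>, the first cofactor may be taken prime to \<open>p\<close>.\<close>
    then obtain k where "k < Suc m" "\<forall>i\<le>k. p ^ i dvd f \<and> p ^ i dvd g"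
        and k': "\<not> (p ^ Suc k dvd f \<and> p ^ Suc k dvd g)"
      using ex_least_nat_less[of "\<lambda>k. \<not> (p ^ k dvd f \<and> p ^ k dvd g)" "Suc m"]
      by (auto simp del: power_Suc)
    then have k: "k \<le> m" "p ^ k dvd f" "p ^ k dvd g" by auto
    then obtain f' g' where fg': "f = p ^ k * f'" "g = p ^ k * g'" by (auto elim!: dvdE)
    show ?thesis
    proof (cases "p dvd f'")
      case False
      then show ?thesis using step[of k f' g'] fg k(1) by (simp add: fg')
    next
      case True
      then have "\<not> p dvd - g'" using k' by (auto simp: fg' mult_dvd_mono mult.commute)
      moreover have "(p ^ k * - g', p ^ k * f') \<in> U" using bU[OF fg(1)] by (simp add: fg')
      ultimately show ?thesis using step k(1) by blast
    qed
  qed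
  then obtain F where F: "\<not> p dvd F" "((p ^ m * F) mod q, 0) \<in> U" by blast
  obtain x y where xy: "x * F + y * p = 1"
    using coprime_poly_bezout[of F p] real_minpoly_coprime[OF mp F(1)] by (auto simp: coprime_commute)
  have "((x * ((p ^ m * F) mod q)) mod q, 0) \<in> U" using hU[OF F(2), of x] by simp
  also have "(x * ((p ^ m * F) mod q)) mod q = (p ^ m * (x * F)) mod q"
    by (simp add: mod_mult_right_eq mult_ac)
  also have "\<dots> = p ^ m mod q"
  proof -
    have "p ^ m * (x * F) - p ^ m = p ^ m * (x * F - 1)" by (simp add: algebra_simps)
    also have "x * F - 1 = p * - y" using xy by (simp add: algebra_simps)
    finally show ?thesis unfolding mod_eq_dvd_iff using q_dvd[of "p * - y"] by (simp only: dvd_triv_left)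
  qed
  finally show ?thesis by (simp only: q_def real_minpoly_power_mod[OF mp])
qed

section \<open>Two facts from linear algebra\<close>

lemma ex_linear_separating:
  fixes S :: "'v::real_vector set"
  assumes "subspace S" "x \<notin> S"
  obtains l :: "'v \<Rightarrow> real" where "linear l" "l x \<noteq> 0" "\<And>y. y \<in> S \<Longrightarrow> l y = 0"
proof -
  obtain B where B: "B \<subseteq> S" "independent B" "S \<subseteq> span B" by (rule maximal_independent_subset)
  have "x \<notin> span B" using span_minimal[OF B(1) assms(1)] assms(2) by blast
  then have "independent (insert x B)" using B(2) by (simp add: independent_insertI)
  from linear_independent_extend[OF this, of "\<lambda>y. if y = x then 1 else 0"]
  obtain l :: "'v \<Rightarrow> real" where l: "linear l" "\<forall>y\<in>insert x B. l y = (if y = x then 1 else 0)"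
    by blast
  have "l y = 0" if "y \<in> S" for y
  proof (rule linear_eq_0_on_span[OF l(1)])
    show "y \<in> span B" using that B(3) by blast
    show "l z = 0" if "z \<in> B" for z
      using l(2) that B(1) assms(2) by auto
  qed
  moreover have "l x \<noteq> 0" using l(2) by simp
  ultimately show thesis using that l(1) by blast
qed

text \<open>A basis of the span maps to an independent set of the same size; a vector missed by \<open>f\<close> would
  enlarge it beyond the dimension.\<close>

lemma linear_endo_surj_on_span:
  fixes f :: "'v::real_vector \<Rightarrow> 'v"
  assumes f: "linear f" and "finite B" and closed: "f ` span B \<subseteq> span B"
    and ker: "\<And>x. x \<in> span B \<Longrightarrow> f x = 0 \<Longrightarrow> x = 0"
  shows "f ` span B = span B"
proof (rule ccontr)
  assume "f ` span B \<noteq> span B"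
  then obtain y where y: "y \<in> span B" "y \<notin> f ` span B" using closed by blast
  obtain C where C: "C \<subseteq> span B" "independent C" "span B \<subseteq> span C"
    by (rule maximal_independent_subset)
  have span_C: "span C = span B" using span_minimal[OF C(1) subspace_span] C(3) by blast
  have inj: "inj_on f (span C)"
    unfolding span_C by (subst linear_inj_on_iff_eq_0[OF f]) (auto simp: ker)
  have fin: "finite C" using independent_span_bound[OF \<open>finite B\<close> C(2,1)] by blast
  have "independent (f ` C)" by (rule linear_independent_injective_image[OF f C(2) inj])
  moreover have "y \<notin> span (f ` C)" using y(2) by (simp add: linear_span_image[OF f] span_C)
  ultimately have "independent (insert y (f ` C))" by (simp add: independent_insertI)
  moreover have "insert y (f ` C) \<subseteq> span C"
    using y(1) closed C(1) by (auto simp: span_C)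
  ultimately have "card (insert y (f ` C)) \<le> card C"
    using independent_span_bound[OF fin] by blast
  moreover have "y \<notin> f ` C" using y(2) C(1) by blast
  moreover have "card (f ` C) = card C"
    using inj by (intro card_image inj_on_subset[OF inj]) (rule span_superset)
  ultimately show False using fin by simp
qed

section \<open>Annihilating polynomials of \<open>a\<close>\<close>

context iD_rep
begin

lemma act_in_span_powers:
  assumes v: "v \<in> V" and w: "w \<in> span ((\<lambda>i. act (iD_a ^ i) v) ` {..<k})"
  obtains f where "f = 0 \<or> degree f < k" "w = act (peval f iD_a) v"
proof -
  let ?S = "{act (peval f iD_a) v |f. f = 0 \<or> degree f < k}"
  have "subspace ?S"
  proof (rule subspaceI)
    show "0 \<in> ?S" using v by (auto intro!: exI[of _ 0])
    fix x y assume "x \<in> ?S" "y \<in> ?S"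
    then obtain f g where "x = act (peval f iD_a) v" "f = 0 \<or> degree f < k"
        "y = act (peval g iD_a) v" "g = 0 \<or> degree g < k" by blast
    then show "x + y \<in> ?S"
      using v by (intro CollectI exI[of _ "f + g"]) (auto simp: act_add_left degree_add_less)
  next
    fix r x assume "x \<in> ?S"
    then obtain f where "x = act (peval f iD_a) v" "f = 0 \<or> degree f < k" by blast
    then show "r *\<^sub>R x \<in> ?S"
      using v by (intro CollectI exI[of _ "smult r f"]) (auto simp: act_scaleR_left)
  qed
  moreover have "act (iD_a ^ i) v \<in> ?S" if "i < k" for i
    using that by (intro CollectI exI[of _ "tpoly ^ i"]) (simp add: tpoly_def degree_linear_power)
  ultimately have "span ((\<lambda>i. act (iD_a ^ i) v) ` {..<k}) \<subseteq> ?S"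
    by (intro span_minimal image_subsetI) simp_all
  then have "w \<in> ?S" using w by (rule subsetD)
  then obtain f where "w = act (peval f iD_a) v" "f = 0 \<or> degree f < k" by blast
  then show thesis by (intro that)
qed

text \<open>In a finite-dimensional space the vectors \<open>v, a v, a\<^sup>2 v, \<dots>\<close> cannot each lie outside the span of
  the preceding ones. One that lies in this span yields an annihilating polynomial.\<close>

lemma ex_annihilator_vector:
  assumes "finite_dimensional V" and v: "v \<in> V"
  obtains f where "f \<noteq> 0" "act (peval f iD_a) v = 0"
proof -
  obtain B where B: "finite B" "span B = V" using assms(1) unfolding finite_dimensional_def by blast
  let ?w = "\<lambda>i. act (iD_a ^ i) v"
  obtain k where k: "?w k \<in> span (?w ` {..<k})"
  proof (rule ccontr)
    assume no: "\<not> thesis"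
    then have new: "?w k \<notin> span (?w ` {..<k})" for k using that by blast
    have ind: "independent (?w ` {..<k}) \<and> card (?w ` {..<k}) = k" for k
    proof (induction k)
      case (Suc k)
      moreover have "?w k \<notin> ?w ` {..<k}" using new[of k] span_base[of "?w k" "?w ` {..<k}"] by blast
      ultimately show ?case
        by (simp add: lessThan_Suc independent_insertI[OF new])
    qed (simp add: independent_empty)
    have "?w ` {..<Suc (card B)} \<subseteq> span B" using v by (auto simp: B act_closed)
    then show False
      using independent_span_bound[OF B(1), of "?w ` {..<Suc (card B)}"] ind[of "Suc (card B)"] by simp
  qed
  obtain f where f: "f = 0 \<or> degree f < k" "?w k = act (peval f iD_a) v"
    by (rule act_in_span_powers[OF v k])
  have "degree (tpoly ^ k) = k" by (simp add: tpoly_def degree_linear_power)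
  then have "tpoly ^ k \<noteq> f" using f(1) by (auto simp: tpoly_def)
  then have "tpoly ^ k - f \<noteq> 0" by simp
  moreover have "act (peval (tpoly ^ k - f) iD_a) v = 0" using f(2) v by (simp add: act_diff_left)
  ultimately show thesis by (rule that)
qed

lemma subspace_ker: "subspace {v \<in> V. act x v = 0}"
  by (rule subspaceI)
    (auto simp: act_add_right act_scaleR_right zero_in subspace_add[OF subspace] subspace_scale[OF subspace])

lemma ex_annihilator:
  assumes "finite_dimensional V"
  obtains f where "f \<noteq> 0" "\<And>v. v \<in> V \<Longrightarrow> act (peval f iD_a) v = 0"
proof -
  obtain B where B: "finite B" "span B = V" using assms unfolding finite_dimensional_def by blast
  have BV: "B \<subseteq> V" using B(2) span_superset by blast
  have "\<exists>f. f \<noteq> 0 \<and> (\<forall>v\<in>C. act (peval f iD_a) v = 0)" if "finite C" "C \<subseteq> V" for C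
    using that
  proof (induction C rule: finite_induct)
    case empty
    then show ?case by (auto intro: exI[of _ 1])
  next
    case (insert v C)
    then obtain f where f: "f \<noteq> 0" "\<And>w. w \<in> C \<Longrightarrow> act (peval f iD_a) w = 0" by auto
    obtain g where g: "g \<noteq> 0" "act (peval g iD_a) v = 0"
      using ex_annihilator_vector[OF assms, of v] insert.prems by blast
    have "act (peval (f * g) iD_a) w = 0" if "w \<in> insert v C" for w
    proof (cases "w = v")
      case True
      then show ?thesis using g(2) insert.prems by (simp add: act_mult)
    next
      case False
      then show ?thesis
        using f(2)[of w] that insert.prems by (auto simp: peval_commute[of f] act_mult)
    qed
    then show ?case using f(1) g(1) by (intro exI[of _ "f * g"]) auto
  qed
  from this[OF B(1) BV] obtain f where f: "f \<noteq> 0" "\<And>v. v \<in> B \<Longrightarrow> act (peval f iD_a) v = 0" by blast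
  have "V \<subseteq> {v \<in> V. act (peval f iD_a) v = 0}"
    using span_minimal[OF _ subspace_ker, of B "peval f iD_a"] BV f(2) B(2) by blast
  then show thesis using that[OF f(1)] by blast
qed

text \<open>Here \<open>p ^ Suc m * r\<close> is an annihilating polynomial of \<open>a\<close> of least degree, and \<open>p\<close> comes from one
  of its complex roots. The last conclusion says that \<open>p ^ m * r\<close> no longer annihilates. The root
  is not zero because \<open>a\<close> is invertible: a factor \<open>t\<close> could be cancelled.\<close>

lemma ex_primary_vector:
  assumes "finite_dimensional V" "V \<noteq> {0}"
  obtains p c m r v where "c \<noteq> 0" "real_minpoly p c" "type1 p \<or> type2 p" "\<not> p dvd r"
    "\<And>w. w \<in> V \<Longrightarrow> act (peval (p ^ Suc m * r) iD_a) w = 0"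
    "v \<in> V" "act (peval r iD_a) (act (peval (p ^ m) iD_a) v) \<noteq> 0"
proof -
  let ?ann = "\<lambda>f. f \<noteq> 0 \<and> (\<forall>v\<in>V. act (peval f iD_a) v = 0)"
  obtain f0 where "?ann f0" using ex_annihilator[OF assms(1)] by metis
  then obtain f where f: "?ann f" and min: "\<And>g. ?ann g \<Longrightarrow> degree f \<le> degree g"
    using ex_has_least_nat[of ?ann f0 degree] by blast
  obtain v0 where v0: "v0 \<in> V" "v0 \<noteq> 0" using assms(2) zero_in by blast
  have "degree f \<noteq> 0"
  proof
    assume "degree f = 0"
    then obtain k where "f = [:k:]" by (rule degree_eq_zeroE)
    then have "k *\<^sub>R v0 = 0" "k \<noteq> 0" using f v0(1) by (auto simp: act_of_real)
    with v0(2) show False by simp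
  qed
  then have "\<not> constant (poly (map_poly complex_of_real f))"
    by (simp add: constant_degree degree_map_poly)
  then obtain c where "poly (map_poly complex_of_real f) c = 0"
    using fundamental_theorem_of_algebra by blast
  then have fc: "peval f c = 0" by (simp add: peval_complex)
  have smaller: "\<exists>v\<in>V. act (peval g iD_a) v \<noteq> 0" if "f = h * g" "degree h > 0" for g h
  proof -
    have "g \<noteq> 0" "h \<noteq> 0" using f that by auto
    then have "degree g < degree f" using that by (simp add: degree_mult_eq)
    then show ?thesis using min[of g] \<open>g \<noteq> 0\<close> by force
  qed
  have "c \<noteq> 0"
  proof
    assume "c = 0"
    then obtain g where g: "f = tpoly * g" using fc by (cases f) (auto simp: tpoly_def)
    then obtain v where v: "v \<in> V" "act (peval g iD_a) v \<noteq> 0"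
      using smaller[OF g] by (auto simp: tpoly_def)
    have "act (peval f iD_a) v = 0" using f v(1) by blast
    then have "act iD_a_inv (act iD_a (act (peval g iD_a) v)) = 0"
      using v(1) by (simp add: g act_mult)
    then show False
      using v act_mult[of "act (peval g iD_a) v" iD_a_inv iD_a]
      by (simp add: iD_relations act_one act_closed)
  qed
  then obtain p where p: "type1 p \<or> type2 p" "real_minpoly p c" by (rule ex_real_minpoly)
  have "p dvd f" using fc real_minpolyD[OF p(2)] by simp
  obtain k r where fr: "f = p ^ k * r" "\<not> p dvd r"
    using multiplicity_decompose'[OF _ prime_elem_not_unit[OF real_minpoly_prime_elem[OF p(2)]], of f] f
    by blast
  then obtain m where k: "k = Suc m" using \<open>p dvd f\<close> by (cases k) auto
  have "f = p * (p ^ m * r)" by (simp add: fr k mult_ac)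
  then obtain v where "v \<in> V" "act (peval (p ^ m * r) iD_a) v \<noteq> 0"
    using smaller real_minpoly_degree_pos[OF p(2)] by blast
  then have "act (peval r iD_a) (act (peval (p ^ m) iD_a) v) \<noteq> 0"
    by (simp add: peval_commute[of "p ^ m"] mult.commute[of "p ^ m"] flip: act_mult peval_mult peval_power)
  moreover have "act (peval (p ^ Suc m * r) iD_a) w = 0" if "w \<in> V" for w
    using f that by (simp only: fr k)
  ultimately show thesis using that \<open>c \<noteq> 0\<close> p fr(2) \<open>v \<in> V\<close> by blast
qed

end

section \<open>Isomorphic representations\<close>

lemma iD_isomorphic_sym:
  assumes V: "iD_rep V act" and iso: "iD_isomorphic V act V' act'"
  shows "iD_isomorphic V' act' V act"
proof -
  interpret iD_rep V act by (rule V)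
  obtain h where h: "bij_betw h V V'" "\<And>v w. v \<in> V \<Longrightarrow> w \<in> V \<Longrightarrow> h (v + w) = h v + h w"
      "\<And>r v. v \<in> V \<Longrightarrow> h (r *\<^sub>R v) = r *\<^sub>R h v" "\<And>x v. v \<in> V \<Longrightarrow> h (act x v) = act' x (h v)"
    using iso unfolding iD_isomorphic_def by blast
  let ?k = "inv_into V h"
  have k: "bij_betw ?k V' V" by (rule bij_betw_inv_into[OF h(1)])
  have kV: "?k v \<in> V" "h (?k v) = v" if "v \<in> V'" for v
    using k h(1) that by (auto simp: bij_betw_def f_inv_into_f intro: inv_into_into)
  have kh: "?k (h v) = v" if "v \<in> V" for v
    using h(1) that by (simp add: bij_betw_def)
  have "?k (v + w) = ?k v + ?k w" if "v \<in> V'" "w \<in> V'" for v w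
    using kh[of "?k v + ?k w"] kV that subspace_add[OF subspace] by (simp add: h(2))
  moreover have "?k (r *\<^sub>R v) = r *\<^sub>R ?k v" if "v \<in> V'" for r v
    using kh[of "r *\<^sub>R ?k v"] kV that subspace_scale[OF subspace] by (simp add: h(3))
  moreover have "?k (act' x v) = act x (?k v)" if "v \<in> V'" for x v
    using kh[of "act x (?k v)"] kV that act_closed by (simp add: h(4))
  ultimately show ?thesis unfolding iD_isomorphic_def using k by blast
qed

lemma iD_isomorphic_refl: "iD_isomorphic V act V act"
  unfolding iD_isomorphic_def by (intro exI[of _ id]) simp

lemma (in iD_rep) indecomposableI:
  assumes "s \<in> V" "s \<noteq> 0" and s: "\<And>U. iD_subrep U V act \<Longrightarrow> U \<noteq> {0} \<Longrightarrow> s \<in> U"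
  shows "indecomposable V act"
  unfolding indecomposable_def using assms by blast

lemma iD_isomorphic_finite_dimensional:
  assumes V: "iD_rep V act" and iso: "iD_isomorphic V act V' act'" and "finite_dimensional V'"
  shows "finite_dimensional V"
proof -
  interpret iD_rep V act by (rule V)
  obtain k where k: "bij_betw k V' V" "\<And>v w. v \<in> V' \<Longrightarrow> w \<in> V' \<Longrightarrow> k (v + w) = k v + k w"
      "\<And>r v. v \<in> V' \<Longrightarrow> k (r *\<^sub>R v) = r *\<^sub>R k v"
    using iD_isomorphic_sym[OF V iso] unfolding iD_isomorphic_def by blast
  obtain B where B: "finite B" "span B = V'" using assms(3) unfolding finite_dimensional_def by blast
  have BV': "B \<subseteq> V'" using B(2) span_superset by blast
  have "span (k ` B) = V"
  proof
    show "span (k ` B) \<subseteq> V"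
      using k(1) BV' by (intro span_minimal subspace) (auto simp: bij_betw_def)
    show "V \<subseteq> span (k ` B)"
    proof
      fix v assume "v \<in> V"
      then obtain w where w: "w \<in> V'" "v = k w" using k(1) by (auto simp: bij_betw_def)
      have sV': "subspace V'" using subspace_span B(2) by blast
      have "subspace {w \<in> V'. k w \<in> span (k ` B)}"
      proof (rule subspaceI)
        have "k 0 = 0" using k(3)[of 0 0] subspace_0[OF sV'] by simp
        then show "0 \<in> {w \<in> V'. k w \<in> span (k ` B)}" using subspace_0[OF sV'] by (simp add: span_zero)
      qed (auto simp: k(2,3) intro: subspace_add[OF sV'] subspace_scale[OF sV'] span_add span_scale)
      moreover have "B \<subseteq> {w \<in> V'. k w \<in> span (k ` B)}" using BV' by (auto intro: span_base)
      ultimately have "span B \<subseteq> {w \<in> V'. k w \<in> span (k ` B)}" by (rule span_minimal[rotated])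
      then show "v \<in> span (k ` B)" using w B(2) by blast
    qed
  qed
  then show ?thesis using B(1) unfolding finite_dimensional_def by blast
qed

text \<open>A subrepresentation of \<open>V\<close> is carried to one of the standard representation, so the preimage of
  the socle vector lies in every nonzero subrepresentation of \<open>V\<close>.\<close>

lemma iD_isomorphic_std_imp:
  assumes V: "iD_rep V act" and type: "type1 p \<or> type2 p"
    and iso: "iD_isomorphic V act (std_space (p ^ Suc m)) (std_act (p ^ Suc m))"
  shows "finite_dimensional V \<and> indecomposable V act"
proof
  let ?q = "p ^ Suc m"
  obtain c where c: "c \<noteq> 0" "real_minpoly p c" using type by (rule type1_or_2_imp_real_minpoly)
  have "?q \<noteq> 0" using real_minpoly_nonzero[OF c(2)] by simp
  from finite_dimensional_std_space[OF this] show "finite_dimensional V"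
    by (rule iD_isomorphic_finite_dimensional[OF V iso])
  interpret V: iD_rep V act by (rule V)
  interpret S: iD_rep "std_space ?q" "std_act ?q" by (rule iD_rep_std[OF type1_or_2_poly_0[OF type]])
  obtain h where h: "bij_betw h V (std_space ?q)" "\<And>v w. v \<in> V \<Longrightarrow> w \<in> V \<Longrightarrow> h (v + w) = h v + h w"
      "\<And>r v. v \<in> V \<Longrightarrow> h (r *\<^sub>R v) = r *\<^sub>R h v" "\<And>x v. v \<in> V \<Longrightarrow> h (act x v) = std_act ?q x (h v)"
    using iso unfolding iD_isomorphic_def by blast
  have inj: "inj_on h V" and im: "h ` V = std_space ?q" using h(1) by (auto simp: bij_betw_def)
  have h0: "h 0 = 0" using h(3)[OF V.zero_in, of 0] by simp
  have "(p ^ m, 0) \<in> h ` V"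
    unfolding im using real_minpoly_power_mod[OF c(2), of m] by (simp add: std_space_def in_poly_quot_iff)
  then obtain s where s: "s \<in> V" "h s = (p ^ m, 0)" by auto
  show "indecomposable V act"
  proof (rule V.indecomposableI[OF s(1)])
    show "s \<noteq> 0" using s(2) h0 real_minpoly_nonzero[OF c(2)] by (auto simp: zero_prod_def)
    fix U assume U: "iD_subrep U V act" "U \<noteq> {0}"
    then have UV: "U \<subseteq> V" and "subspace U" and Uact: "\<And>x u. u \<in> U \<Longrightarrow> act x u \<in> U"
      unfolding V.subrep_iff by auto
    have "iD_subrep (h ` U) (std_space ?q) (std_act ?q)"
      unfolding S.subrep_iff
    proof (intro conjI allI ballI)
      show "h ` U \<subseteq> std_space ?q" using UV im by blast
      show "subspace (h ` U)"
      proof (rule subspaceI)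
        show "0 \<in> h ` U" using h0 subspace_0[OF \<open>subspace U\<close>] by force
        show "x + y \<in> h ` U" if "x \<in> h ` U" "y \<in> h ` U" for x y
          using that UV subspace_add[OF \<open>subspace U\<close>] by (auto simp: subset_iff simp flip: h(2))
        show "r *\<^sub>R x \<in> h ` U" if "x \<in> h ` U" for x r
          using that UV subspace_scale[OF \<open>subspace U\<close>] by (auto simp: subset_iff simp flip: h(3))
      qed
      show "std_act ?q x w \<in> h ` U" if "w \<in> h ` U" for x w
        using that UV Uact by (auto simp: subset_iff simp flip: h(4) simp del: power_Suc)
    qed
    moreover have "h ` U \<noteq> {0}"
    proof
      assume "h ` U = {0}"
      then have "u = 0" if "u \<in> U" for u
        using that UV inj h0 V.zero_in by (metis imageI inj_onD singletonD subsetD)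
      with U(2) subspace_0[OF \<open>subspace U\<close>] show False by blast
    qed
    ultimately have "h s \<in> h ` U" unfolding s(2) by (rule socle_in_subrep[OF c])
    then show "s \<in> U" using inj UV s(1) by (auto dest: inj_onD)
  qed
qed

section \<open>Splitting off a standard representation\<close>

lemma coeff_sum_monom: "coeff (\<Sum>i<N. monom (x i) i) j = (if j < N then x j else 0)"
  for x :: "nat \<Rightarrow> real"
  by (simp add: coeff_sum)

context iD_rep
begin

text \<open>The vector \<open>v\<close> generates a copy \<open>M\<close> of the standard representation, and the functional \<open>l\<close> cuts
  out a complement \<open>W\<close>, the largest subrepresentation inside its kernel. That \<open>l\<close> vanishes on the
  image of \<open>p ^ Suc m (a)\<close> makes \<open>l (f(a) w)\<close> depend on \<open>f\<close> only modulo \<open>p ^ Suc m\<close>. Hence the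
  codimension of \<open>W\<close> is at most the dimension of the standard representation. That \<open>l\<close> does not
  vanish at \<open>p ^ m (a) v\<close>, the socle vector of \<open>M\<close>, makes \<open>M\<close> and \<open>W\<close> independent.\<close>

lemma ex_std_direct_summand:
  fixes l :: "'v \<Rightarrow> real"
  assumes c: "c \<noteq> 0" "real_minpoly p c"
    and v: "v \<in> V" and pv: "act (peval (p ^ Suc m) iD_a) v = 0"
    and l: "linear l" and lq: "\<And>w. w \<in> V \<Longrightarrow> l (act (peval (p ^ Suc m) iD_a) w) = 0"
    and lv: "l (act (peval (p ^ m) iD_a) v) \<noteq> 0"
  obtains M W where "iD_subrep M V act" "iD_subrep W V act" "M \<inter> W = {0}"
    "V = {x + y |x y. x \<in> M \<and> y \<in> W}" "M \<noteq> {0}"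
    "iD_isomorphic (std_space (p ^ Suc m)) (std_act (p ^ Suc m)) M act"
proof -
  define q where "q = p ^ Suc m"
  define u where "u = t_inv q"
  define N where "N = degree q"
  define P where "P f = act (peval f iD_a)" for f
  have q0: "poly q 0 \<noteq> 0" using real_minpoly_poly_0[OF c] by (simp add: q_def)
  then have "q \<noteq> 0" by auto
  have N: "0 < N"
    using real_minpoly_degree_pos[OF c(2)] real_minpoly_nonzero[OF c(2)]
    by (simp add: N_def q_def degree_power_eq degree_mult_eq)
  interpret S: iD_rep "std_space q" "std_act q" by (rule iD_rep_std[OF q0])
  have tu: "(tpoly * u) mod q = 1 mod q" using t_inv[OF q0] by (simp add: u_def)
  have ftu: "(f * u * tpoly) mod q = f mod q" for f
    using mod_mult_cong[OF refl tu, of f] by (simp add: mult_ac)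

  have PV: "P f w \<in> V" if "w \<in> V" for f w using that by (simp add: P_def act_closed)
  have P_mult: "P (f * g) w = P f (P g w)" if "w \<in> V" for f g w
    using that by (simp add: P_def act_mult)
  have P_add: "P (f + g) w = P f w + P g w" if "w \<in> V" for f g w
    using that by (simp add: P_def act_add_left)
  have P_scale: "P (smult r f) w = r *\<^sub>R P f w" if "w \<in> V" for r f w
    using that by (simp add: P_def act_scaleR_left)
  have P_1: "P 1 w = w" if "w \<in> V" for w using that by (simp add: P_def act_one)
  have P_t: "P tpoly w = act iD_a w" for w by (simp add: P_def)
  have P_sum: "P f w = (\<Sum>i<N. coeff f i *\<^sub>R act (iD_a ^ i) w)" if "degree f < N" "w \<in> V" for f w
    using that by (simp add: P_def peval_eq_sum act_sum_left act_scaleR_left)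
  have ainv: "P f (act iD_a_inv w) = act iD_a_inv (P f w)" if "w \<in> V" for f w
    using that by (simp add: P_def peval_a_a_inv flip: act_mult)
  have a_ainv: "act iD_a (act iD_a_inv w) = w" "act iD_a_inv (act iD_a w) = w" if "w \<in> V" for w
    using that by (simp_all add: iD_relations act_one flip: act_mult)

  have l_mod: "l (P (f mod q) w) = l (P f w)" if w: "w \<in> V" for f w
  proof -
    have "P f w = P (q * (f div q)) w + P (f mod q) w" using P_add[OF w] by (metis mult_div_mod_eq)
    moreover have "l (P (q * (f div q)) w) = 0"
      unfolding P_mult[OF w] using lq[OF PV[OF w]] by (simp add: P_def q_def)
    ultimately show ?thesis by (simp add: linear_add[OF l])
  qed
  have l_cong: "l (P f w) = l (P g w)" if "f mod q = g mod q" "w \<in> V" for f g w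
    using l_mod that by metis
  \<comment> \<open>Under \<open>l\<close>, the inverse of \<open>a\<close> is as good as the polynomial
    \<open>u\<close> in \<open>a\<close>.\<close>
  have l_ainv: "l (P f (act iD_a_inv w)) = l (P (f * u) w)" if w: "w \<in> V" for f w
  proof -
    have "P (f * u) w = P (f * u * tpoly) (act iD_a_inv w)"
      using w by (simp add: P_mult PV P_t a_ainv act_closed)
    then show ?thesis using l_cong[OF ftu] w act_closed by simp
  qed
  have v_mod: "P (f mod q) v = P f v" for f
  proof -
    have "P f v = P ((f div q) * q) v + P (f mod q) v" using P_add[OF v] by (metis div_mult_mod_eq)
    moreover have "P q v = 0" using pv by (simp add: P_def q_def)
    ultimately show ?thesis by (simp add: P_mult[OF v]) (simp add: P_def)
  qed
  have v_ainv: "act iD_a_inv (P f v) = P (u * f) v" for f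
  proof -
    have "act iD_a (P (u * f) v) = P (f * u * tpoly) v"
      using v by (simp add: P_mult PV flip: P_t) (metis P_mult PV mult.commute)
    also have "\<dots> = P f v" using ftu v_mod by metis
    finally show ?thesis using a_ainv(2)[OF PV[OF v]] by metis
  qed

  define W where "W = {w \<in> V. \<forall>f. l (P f w) = 0 \<and> l (P f (act iD_b w)) = 0}"
  have W: "iD_subrep W V act"
  proof (rule subrepI)
    show "W \<subseteq> V" by (auto simp: W_def)
    show "subspace W"
      by (rule subspaceI)
        (auto simp: W_def P_def zero_in act_add_right act_scaleR_right act_closed
          linear_0[OF l] linear_add[OF l] linear_scale[OF l]
          intro: subspace_add[OF subspace] subspace_scale[OF subspace])
    fix w assume w: "w \<in> W"
    then have wV: "w \<in> V" and lw: "\<And>f. l (P f w) = 0" "\<And>f. l (P f (act iD_b w)) = 0"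
      by (auto simp: W_def)
    have ba: "act iD_b (act iD_a w) = act iD_a_inv (act iD_b w)"
      and bai: "act iD_b (act iD_a_inv w) = act iD_a (act iD_b w)"
      and bb: "act iD_b (act iD_b w) = - w"
      using wV by (simp_all add: iD_b_a iD_a_b iD_relations act_minus_left act_one flip: act_mult)
    have Pa: "P f (act iD_a x) = P (f * tpoly) x" if "x \<in> V" for f x
      using that by (simp add: P_mult P_t)
    show "act iD_a w \<in> W"
      using wV lw by (simp add: W_def act_closed ba Pa l_ainv)
    show "act iD_a_inv w \<in> W"
      using wV lw by (simp add: W_def act_closed bai Pa l_ainv)
    have "P f (- w) = - P f w" for f using wV by (simp add: P_def act_minus_right)
    then show "act iD_b w \<in> W"
      using wV lw by (simp add: W_def act_closed bb linear_neg[OF l])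
  qed

  \<comment> \<open>\<open>j\<close> embeds the standard representation as the subrepresentation generated by
    \<open>v\<close>.\<close>
  define j where "j s = P (fst s) v + act iD_b (P (snd s) v)" for s
  have lin_j: "linear j"
    by (rule linearI) (simp_all add: j_def P_add[OF v] P_scale[OF v] scaleR_poly_eq_smult
        act_add_right act_scaleR_right PV[OF v] scaleR_add_right)
  have jV: "j s \<in> V" for s
    by (simp add: j_def act_closed PV[OF v] subspace_add[OF subspace])
  have j_act: "j (std_act q x s) = act x (j s)" if "s \<in> std_space q" for x s
  proof (rule intertwinerI[OF S.iD_rep_axioms iD_rep_axioms jV _ _ _ _ that])
    fix s assume "s \<in> std_space q"
    then obtain f g where s: "s = (f, g)" "f \<in> poly_quot q" "g \<in> poly_quot q"
      by (auto simp: std_space_def)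
    have "act iD_a (act iD_b (P g v)) = act iD_b (act iD_a_inv (P g v))"
      using PV[OF v] by (simp add: iD_a_b flip: act_mult)
    then show "j (std_act q iD_a s) = act iD_a (j s)"
      using v by (simp add: s std_act_a_b[OF q0] j_def v_mod v_ainv u_def act_add_right
          act_closed PV P_mult P_t)
    have "act iD_b (act iD_b (P g v)) = - P g v"
      using PV[OF v] by (simp add: iD_relations act_minus_left act_one flip: act_mult)
    moreover have "P (- g) v = - P g v" using v by (simp add: P_def act_minus_left)
    ultimately show "j (std_act q iD_b s) = act iD_b (j s)"
      using v by (simp add: s std_act_a_b[OF q0] j_def act_add_right act_closed PV)
  qed (simp_all add: linear_add[OF lin_j] linear_scale[OF lin_j])

  \<comment> \<open>\<open>K\<close> is the kernel of \<open>\<Phi> \<circ> j\<close> for the map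
    \<open>\<Phi>\<close> below, whose kernel is \<open>W\<close>.\<close>
  define K where "K = {s \<in> std_space q. j s \<in> W}"
  have W_sub: "subspace W" and W_act: "\<And>x w. w \<in> W \<Longrightarrow> act x w \<in> W"
    using W by (auto simp: subrep_iff)
  have "K = {0}"
  proof (rule ccontr)
    assume "K \<noteq> {0}"
    moreover have "iD_subrep K (std_space q) (std_act q)"
      unfolding S.subrep_iff
    proof (intro conjI allI ballI)
      show "subspace K"
        by (rule subspaceI)
          (auto simp: K_def S.zero_in linear_0[OF lin_j] linear_add[OF lin_j] linear_scale[OF lin_j]
            intro: subspace_0[OF W_sub] subspace_add[OF W_sub] subspace_scale[OF W_sub]
              subspace_add[OF S.subspace] subspace_scale[OF S.subspace])
      show "std_act q x s \<in> K" if "s \<in> K" for x s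
        using that by (simp add: K_def S.act_closed j_act W_act)
    qed (auto simp: K_def)
    ultimately have "(p ^ m, 0) \<in> K" unfolding q_def by (intro socle_in_subrep[OF c])
    then have "l (P 1 (j (p ^ m, 0))) = 0" by (simp add: K_def W_def)
    then have "l (P (p ^ m) v) = 0"
      using v by (simp add: P_1[OF jV]) (simp add: j_def P_def)
    with lv show False by (simp add: P_def)
  qed

  define \<Phi> where "\<Phi> w = (\<Sum>i<N. monom (l (act (iD_a ^ i) w)) i,
    \<Sum>i<N. monom (l (act (iD_a ^ i) (act iD_b w))) i)" for w
  have \<Phi>_add: "\<Phi> (w + w') = \<Phi> w + \<Phi> w'" if "w \<in> V" "w' \<in> V" for w w'
    using that by (simp add: \<Phi>_def act_add_right act_closed linear_add[OF l] add_monom[symmetric] sum.distrib)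
  have \<Phi>_scale: "\<Phi> (r *\<^sub>R w) = r *\<^sub>R \<Phi> w" if "w \<in> V" for r w
    using that by (simp add: \<Phi>_def act_scaleR_right act_closed linear_scale[OF l] prod_eq_iff
        poly_eq_iff coeff_sum_monom)
  have \<Phi>_std: "\<Phi> w \<in> std_space q" for w
  proof -
    have "(\<Sum>i<N. monom (x i) i) \<in> poly_quot q" for x :: "nat \<Rightarrow> real"
    proof -
      have "degree (\<Sum>i<N. monom (x i) i) < N"
        using N by (intro degree_sum_less) (auto intro: le_less_trans[OF degree_monom_le])
      then show ?thesis by (simp add: in_poly_quot_iff_degree[OF \<open>q \<noteq> 0\<close>] N_def)
    qed
    then show ?thesis by (simp add: \<Phi>_def std_space_def)
  qed
  have \<Phi>_ker: "w \<in> W" if w: "w \<in> V" and "\<Phi> w = 0" for w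
  proof -
    have zero: "l (act (iD_a ^ i) w) = 0" "l (act (iD_a ^ i) (act iD_b w)) = 0" if "i < N" for i
      using \<open>\<Phi> w = 0\<close> that coeff_sum_monom[of "\<lambda>i. l (act (iD_a ^ i) w)" N i]
        coeff_sum_monom[of "\<lambda>i. l (act (iD_a ^ i) (act iD_b w))" N i]
      by (auto simp: \<Phi>_def zero_prod_def)
    have "l (P f x) = 0" if x: "x \<in> V" and "\<And>i. i < N \<Longrightarrow> l (act (iD_a ^ i) x) = 0" for f x
    proof -
      have "degree (f mod q) < N"
        using degree_mod_less[OF \<open>q \<noteq> 0\<close>, of f] N by (auto simp: N_def)
      then have "l (P (f mod q) x) = 0"
        using that by (simp add: P_sum linear_sum[OF l] linear_scale[OF l])
      then show ?thesis by (simp add: l_mod[OF x])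
    qed
    then show ?thesis using w zero by (simp add: W_def act_closed)
  qed

  have lin: "linear (\<lambda>s. \<Phi> (j s))"
    by (rule linearI) (simp_all add: linear_add[OF lin_j] linear_scale[OF lin_j] \<Phi>_add \<Phi>_scale jV)
  obtain B where B: "finite B" "span B = std_space q"
    using finite_dimensional_std_space[OF \<open>q \<noteq> 0\<close>] unfolding finite_dimensional_def by blast
  have "s = 0" if "s \<in> std_space q" "\<Phi> (j s) = 0" for s
  proof -
    have "s \<in> K" using \<Phi>_ker[OF jV that(2)] that(1) by (simp add: K_def)
    then show ?thesis using \<open>K = {0}\<close> by blast
  qed
  then have surj: "(\<lambda>s. \<Phi> (j s)) ` std_space q = std_space q"
    using linear_endo_surj_on_span[OF lin B(1)] \<Phi>_std unfolding B(2) by blast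

  let ?M = "j ` std_space q"
  have M: "iD_subrep ?M V act"
    unfolding subrep_iff
  proof (intro conjI allI ballI)
    show "?M \<subseteq> V" using jV by blast
    show "subspace ?M" by (rule linear_subspace_image[OF lin_j S.subspace])
    show "act x w \<in> ?M" if "w \<in> ?M" for x w
      using that S.act_closed by (auto simp flip: j_act)
  qed
  have 0: "0 \<in> ?M" "0 \<in> W" using subspace_0[of ?M] subspace_0[of W] M W_sub by (simp_all add: subrep_iff)
  have "x = 0" if "x \<in> ?M" "x \<in> W" for x
  proof -
    from that obtain s where s: "s \<in> K" "x = j s" by (auto simp: K_def)
    with \<open>K = {0}\<close> have "s = 0" by blast
    with s(2) show ?thesis by (simp add: linear_0[OF lin_j])
  qed
  with 0 have "?M \<inter> W = {0}" by blast
  moreover have "V = {x + y |x y. x \<in> ?M \<and> y \<in> W}"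
  proof
    show "{x + y |x y. x \<in> ?M \<and> y \<in> W} \<subseteq> V"
      using jV by (auto simp: W_def intro: subspace_add[OF subspace])
    show "V \<subseteq> {x + y |x y. x \<in> ?M \<and> y \<in> W}"
    proof
      fix w assume w: "w \<in> V"
      have "\<Phi> w \<in> (\<lambda>s. \<Phi> (j s)) ` std_space q" unfolding surj by (rule \<Phi>_std)
      then obtain s where s: "s \<in> std_space q" "\<Phi> w = \<Phi> (j s)" by blast
      have d: "w - j s \<in> V" using w jV subspace_diff[OF subspace] by blast
      have "\<Phi> (w - j s) = 0" using \<Phi>_add[OF d jV[of s]] s(2) by simp
      then have "w - j s \<in> W" using \<Phi>_ker d by blast
      moreover have "w = j s + (w - j s)" by simp
      ultimately show "w \<in> {x + y |x y. x \<in> ?M \<and> y \<in> W}" using s(1) by blast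
    qed
  qed
  moreover have inj: "inj_on j (std_space q)"
  proof (subst linear_inj_on_iff_eq_0[OF lin_j S.subspace], intro ballI impI)
    fix s assume "s \<in> std_space q" "j s = 0"
    then have "s \<in> K" using 0 by (simp add: K_def)
    then show "s = 0" using \<open>K = {0}\<close> by blast
  qed
  moreover have "?M \<noteq> {0}"
  proof
    assume "?M = {0}"
    moreover have "(p ^ m, 0) \<in> std_space q"
      using real_minpoly_power_mod[OF c(2), of m] by (simp add: std_space_def in_poly_quot_iff q_def)
    ultimately have "j (p ^ m, 0) = 0" by blast
    then have "P (p ^ m) v = 0" using v by (simp add: j_def) (simp add: P_def)
    with lv show False by (simp add: P_def linear_0[OF l])
  qed
  moreover have "iD_isomorphic (std_space q) (std_act q) ?M act"
    unfolding iD_isomorphic_def using inj j_act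
    by (intro exI[of _ j]) (simp add: bij_betw_def linear_add[OF lin_j] linear_scale[OF lin_j])
  ultimately show thesis using that M W unfolding q_def by blast
qed

text \<open>It remains to supply the functional: \<open>p ^ m (a) v\<close> is not in the image of \<open>p ^ Suc m (a)\<close>. If it
  were, it would be annihilated by \<open>r(a)\<close> as well as by \<open>p ^ Suc m (a)\<close>, hence by
  \<open>1 = x * p ^ Suc m + y * r\<close>.\<close>

lemma indecomposable_imp_iso_std:
  assumes "finite_dimensional V" "indecomposable V act"
  obtains p m where "type1 p \<or> type2 p"
    "iD_isomorphic V act (std_space (p ^ Suc m)) (std_act (p ^ Suc m))"
proof -
  have "V \<noteq> {0}" using assms(2) by (simp add: indecomposable_def)
  from assms(1) this obtain p c m r u where c: "c \<noteq> 0" "real_minpoly p c" "type1 p \<or> type2 p"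
    and r: "\<not> p dvd r" and ann: "\<And>w. w \<in> V \<Longrightarrow> act (peval (p ^ Suc m * r) iD_a) w = 0"
    and u: "u \<in> V" and nz: "act (peval r iD_a) (act (peval (p ^ m) iD_a) u) \<noteq> 0"
    by (rule ex_primary_vector) blast
  define P where "P f = act (peval f iD_a)" for f
  have PV: "P f w \<in> V" if "w \<in> V" for f w using that by (simp add: P_def act_closed)
  have P_mult: "P f (P g w) = P (f * g) w" if "w \<in> V" for f g w
    using that by (simp add: P_def act_mult)
  have P_add: "P (f + g) w = P f w + P g w" if "w \<in> V" for f g w
    using that by (simp add: P_def act_add_left)
  have P_1: "P 1 w = w" if "w \<in> V" for w using that by (simp add: P_def act_one)
  obtain x y where xy: "x * p ^ Suc m + y * r = 1"
    by (rule coprime_poly_bezout[of "p ^ Suc m" r])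
      (use real_minpoly_coprime[OF c(2) r] in simp)
  define v where "v = P r u"
  have v: "v \<in> V" using u by (simp add: v_def PV)
  have pv: "P (p ^ Suc m) v = 0" using ann[OF u] u by (simp only: v_def P_mult) (simp only: P_def)
  let ?S = "P (p ^ Suc m) ` V"
  have "subspace ?S"
  proof (rule subspaceI)
    show "0 \<in> ?S" using zero_in by (auto simp: P_def intro!: image_eqI[of _ _ 0])
    show "w + w' \<in> ?S" if "w \<in> ?S" "w' \<in> ?S" for w w'
      using that subspace_add[OF subspace] by (auto simp: P_def simp flip: act_add_right)
    show "k *\<^sub>R w \<in> ?S" if "w \<in> ?S" for w k
      using that subspace_scale[OF subspace] by (auto simp: P_def simp flip: act_scaleR_right)
  qed
  moreover have "P (p ^ m) v \<notin> ?S"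
  proof
    assume "P (p ^ m) v \<in> ?S"
    then obtain z where z: "z \<in> V" "P (p ^ m) v = P (p ^ Suc m) z" by blast
    let ?w = "P (p ^ m) v"
    have "P r ?w = P (p ^ Suc m * r) z" using z by (simp only: P_mult mult.commute)
    then have "P (y * r) ?w = 0" using ann[OF z(1)] v
      by (simp add: PV flip: P_mult) (simp add: P_def)
    moreover have "P (p ^ Suc m) ?w = P (p ^ m) (P (p ^ Suc m) v)"
      using v by (simp only: P_mult mult.commute)
    then have "P (x * p ^ Suc m) ?w = 0" using pv v
      by (simp only: PV flip: P_mult) (simp add: P_def)
    moreover have "?w = P (x * p ^ Suc m + y * r) ?w" using P_1[OF PV[OF v]] by (simp only: xy)
    moreover have "P (x * p ^ Suc m + y * r) ?w = P (x * p ^ Suc m) ?w + P (y * r) ?w"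
      by (rule P_add[OF PV[OF v]])
    ultimately have "?w = 0" by (metis add_0)
    moreover have "?w = P r (P (p ^ m) u)" using u by (simp only: v_def P_mult mult.commute)
    ultimately show False using nz by (simp add: P_def)
  qed
  ultimately obtain l :: "'v \<Rightarrow> real" where l: "linear l" "l (P (p ^ m) v) \<noteq> 0"
      "\<And>w. w \<in> ?S \<Longrightarrow> l w = 0" by (rule ex_linear_separating) blast
  obtain M W where MW: "iD_subrep M V act" "iD_subrep W V act" "M \<inter> W = {0}"
      "V = {x + y |x y. x \<in> M \<and> y \<in> W}" "M \<noteq> {0}"
      "iD_isomorphic (std_space (p ^ Suc m)) (std_act (p ^ Suc m)) M act"
    by (rule ex_std_direct_summand[OF c(1,2) v pv[unfolded P_def] l(1) _ l(2)[unfolded P_def]])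
      (use l(3) in \<open>auto simp: P_def\<close>)
  have "W = {0}" using assms(2) MW(1-5) unfolding indecomposable_def by blast
  then have "V = M" using MW(4) by auto
  then have "iD_isomorphic (std_space (p ^ Suc m)) (std_act (p ^ Suc m)) V act"
    using MW(6) by simp
  from iD_isomorphic_sym[OF iD_rep_std[OF type1_or_2_poly_0[OF c(3)]] this]
  show thesis using that c(3) by blast
qed

end

section \<open>The classification\<close>

theorem theorem1p1:
  fixes V :: "'v::real_vector set" and act :: "iDinf \<Rightarrow> 'v \<Rightarrow> 'v"
  shows "(\<forall>p n. n \<ge> 1 \<and> (type1 p \<or> type2 p) \<longrightarrow>
            iD_rep (std_space (p ^ n)) (std_act (p ^ n)) \<and>
            finite_dimensional (std_space (p ^ n)) \<and>
            indecomposable (std_space (p ^ n)) (std_act (p ^ n))) \<and>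
         (iD_rep V act \<longrightarrow>
            (finite_dimensional V \<and> indecomposable V act \<longleftrightarrow>
              (\<exists>p n. n \<ge> 1 \<and> (type1 p \<or> type2 p) \<and>
                iD_isomorphic V act (std_space (p ^ n)) (std_act (p ^ n)))))"
proof (intro conjI allI impI)
  fix p :: "real poly" and n :: nat
  assume pn: "n \<ge> 1 \<and> (type1 p \<or> type2 p)"
  then show rep: "iD_rep (std_space (p ^ n)) (std_act (p ^ n))"
    by (intro iD_rep_std type1_or_2_poly_0) blast
  obtain m where "n = Suc m" using pn by (cases n) auto
  with pn rep iD_isomorphic_std_imp[of "std_space (p ^ n)" "std_act (p ^ n)" p m]
  show "finite_dimensional (std_space (p ^ n))" "indecomposable (std_space (p ^ n)) (std_act (p ^ n))"
    using iD_isomorphic_refl by blast+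
next
  assume V: "iD_rep V act"
  show "finite_dimensional V \<and> indecomposable V act \<longleftrightarrow>
      (\<exists>p n. n \<ge> 1 \<and> (type1 p \<or> type2 p) \<and>
        iD_isomorphic V act (std_space (p ^ n)) (std_act (p ^ n)))" (is "_ \<longleftrightarrow> ?std")
  proof
    assume "finite_dimensional V \<and> indecomposable V act"
    then obtain p m where "type1 p \<or> type2 p"
        "iD_isomorphic V act (std_space (p ^ Suc m)) (std_act (p ^ Suc m))"
      using iD_rep.indecomposable_imp_iso_std[OF V] by blast
    then show ?std by (intro exI[of _ p] exI[of _ "Suc m"]) simp
  next
    assume ?std
    then obtain p m where "type1 p \<or> type2 p"
        "iD_isomorphic V act (std_space (p ^ Suc m)) (std_act (p ^ Suc m))"
      by (metis Suc_le_D One_nat_def)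
    then show "finite_dimensional V \<and> indecomposable V act"
      using iD_isomorphic_std_imp[OF V] by blast
  qed
qed

end
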